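(* Let $\mathcal{U}$ be the hypercircle associated to the unit $u(t)\in\mathbb{L}(t)$, and let $v(t)$ be the inverse of $u(t)$ under composition. Let $$v\left(\sum_{i=0}^{n-1}\alpha^iX_i\right)=\sum_{i=0}^{n-1}\frac{r_i(X_0,\ldots,X_{n-1})}{s(X_0,\ldots,X_{n-1})}\alpha^i,$$ where $r_i,s\in\mathbb{K}[X_0,\ldots,X_{n-1}]$. Then the ideal of $\mathcal{U}$ is the elimination ideal with respect to $Z$: $$\mathcal{I}(\mathcal{U})=(r_1(\bar{X}),\ldots,r_{n-1}(\bar{X}),s(\bar{X})Z-1)\cap\mathbb{F}[X_0,\ldots,X_{n-1}].$$
   Context: $\mathbb{K}$ is a field of characteristic zero, $\mathbb{L}=\mathbb{K}(\alpha)$ is a finite algebraic extension of $\mathbb{K}$ of degree $n$ with primitive element $\alpha$, and $\mathbb{F}$ is the algebraic closure of $\mathbb{K}$. A unit of $\mathbb{L}(t)$ (under composition) is a rational function $u(t)=\frac{at+b}{ct+d}$ with $a,b,c,d\in\mathbb{L}$, $ad-bc\neq 0$; its inverse is $v(t)=\frac{-dt+b}{ct-a}$. Every unit $u(t)\in\mathbb{L}(t)$ is written uniquely as $u(t)=\sum_{i=0}^{n-1}\phi_i(t)\alpha^i$ with $\phi_i(t)\in\mathbb{K}(t)$, and the $\alpha$-hypercircle (or simply hypercircle) generated by, or associated to, $u(t)$ is the rational curve in $\mathbb{F}^n$ parametrized by $(\phi_0(t),\ldots,\phi_{n-1}(t))$ (Zariski closure of the image). Likewise, every element of $\mathbb{L}(X_0,\ldots,X_{n-1})$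 has a unique expansion in the powers $1,\alpha,\ldots,\alpha^{n-1}$ with coefficients in $\mathbb{K}(X_0,\ldots,X_{n-1})$. Here $\bar{X}=(X_0,\ldots,X_{n-1})$, $Z$ is a new variable, the ideal on the right is generated in $\mathbb{F}[Z,X_0,\ldots,X_{n-1}]$ before intersecting, and $\mathcal{I}(\mathcal{U})$ is the ideal of polynomials in $\mathbb{F}[X_0,\ldots,X_{n-1}]$ vanishing on $\mathcal{U}$.
   Formalization: Added assumption: no common factor in K[X] of r_0,…,r_{n-1}, s vanishes identically on U (true in lowest terms). Without it the claim fails: for u=t, α=i, the choice r_0=X_0X_1, r_1=X_1^2, s=X_1 gives the unit ideal. *)

theory Defs
  imports
    "HOL-Algebra.Algebraic_Closure_Type"
    "HOL-Algebra.Generated_Fields"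
    "HOL-Computational_Algebra.Fraction_Field"
    "HOL-Library.Poly_Mapping"
    "HOL-Library.FuncSet"
begin

section \<open>Rational functions in one variable\<close>

text \<open>
  All fields live inside the type \<open>'f\<close> of the algebraic closure \<open>F\<close>, and \<open>K\<close> and \<open>L\<close> are subsets
  of it. So \<open>F(t)\<close> is the type \<open>'f poly fract\<close>, and \<open>K(t)\<close>, \<open>L(t)\<close> are subsets of that type.
\<close>

abbreviation field_of :: "'f::field itself \<Rightarrow> 'f ring" where
  "field_of _ \<equiv> ring_of_type_algebra"

definition rat_over :: "'f::field set \<Rightarrow> 'f poly fract set" where
  "rat_over K = {Fract p q | p q. set (coeffs p) \<subseteq> K \<and> set (coeffs q) \<subseteq> K \<and> q \<noteq> 0}"

definition rat_const :: "'f::field \<Rightarrow> 'f poly fract" where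
  "rat_const c = Fract [:c:] 1"

definition rat_t :: "'f::field poly fract" where
  "rat_t = Fract [:0, 1:] 1"

text \<open>
  Substitution of an element \<open>y\<close> of a field extension into a rational function, where the embedding
  \<open>h\<close> says how the constants are to be read in the extension. It is defined as soon as some fraction
  representing \<open>f\<close> has a denominator that does not vanish at \<open>y\<close>; the value does not depend on the
  fraction chosen. Where it is not defined, \<open>rat_subst\<close> is an unspecified value.
\<close>

definition rat_defined :: "('f::field \<Rightarrow> 'e::field) \<Rightarrow> 'f poly fract \<Rightarrow> 'e \<Rightarrow> bool" where
  "rat_defined h f y \<longleftrightarrow> (\<exists>p q. f = Fract p q \<and> poly (map_poly h q) y \<noteq> 0)"

definition rat_subst :: "('f::field \<Rightarrow> 'e::field) \<Rightarrow> 'f poly fract \<Rightarrow> 'e \<Rightarrow> 'e" where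
  "rat_subst h f y =
     (THE z. \<exists>p q. f = Fract p q \<and> poly (map_poly h q) y \<noteq> 0 \<and>
                   z = poly (map_poly h p) y / poly (map_poly h q) y)"

definition rat_comp :: "'f::field poly fract \<Rightarrow> 'f poly fract \<Rightarrow> 'f poly fract" where
  "rat_comp f g = rat_subst rat_const f g"

definition is_unit_in :: "'f::field set \<Rightarrow> 'f poly fract \<Rightarrow> bool" where
  "is_unit_in L u \<longleftrightarrow>
     (\<exists>a\<in>L. \<exists>b\<in>L. \<exists>c\<in>L. \<exists>d\<in>L. a * d - b * c \<noteq> 0 \<and> u = Fract [:b, a:] [:d, c:])"

definition is_comp_inverse :: "'f::field poly fract \<Rightarrow> 'f poly fract \<Rightarrow> bool" where
  "is_comp_inverse u v \<longleftrightarrow>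
     rat_defined rat_const u v \<and> rat_comp u v = rat_t \<and>
     rat_defined rat_const v u \<and> rat_comp v u = rat_t"


section \<open>Polynomials in several variables\<close>

text \<open>
  The variables are indexed by \<open>nat\<close>. For a fixed \<open>n\<close>, the variables \<open>0, \<dots>, n - 1\<close> are
  \<open>X\<^sub>0, \<dots>, X\<^bsub>n-1\<^esub>\<close> and the variable \<open>n\<close> is the extra variable \<open>Z\<close>.
\<close>

type_synonym 'f mpoly = "(nat \<Rightarrow>\<^sub>0 nat) \<Rightarrow>\<^sub>0 'f"

definition mconst :: "'f::field \<Rightarrow> 'f mpoly" where
  "mconst c = Poly_Mapping.single 0 c"

definition mvar :: "nat \<Rightarrow> 'f::field mpoly" where
  "mvar i = Poly_Mapping.single (Poly_Mapping.single i 1) 1"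

definition mpoly_over :: "'f::field set \<Rightarrow> nat set \<Rightarrow> 'f mpoly set" where
  "mpoly_over K V =
     {p. \<forall>m\<in>Poly_Mapping.keys p. Poly_Mapping.lookup p m \<in> K \<and> Poly_Mapping.keys m \<subseteq> V}"

definition mpoly_ring :: "'f::field itself \<Rightarrow> nat set \<Rightarrow> 'f mpoly ring" where
  "mpoly_ring _ V = (ring_of_type_algebra :: 'f mpoly ring)\<lparr>carrier := mpoly_over UNIV V\<rparr>"

definition meval :: "(nat \<Rightarrow> 'f) \<Rightarrow> 'f::field mpoly \<Rightarrow> 'f" where
  "meval x p =
     (\<Sum>m\<in>Poly_Mapping.keys p.
        Poly_Mapping.lookup p m * (\<Prod>i\<in>Poly_Mapping.keys m. x i ^ Poly_Mapping.lookup m i))"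

definition mrat_const :: "'f::field \<Rightarrow> 'f mpoly fract" where
  "mrat_const c = Fract (mconst c) 1"


section \<open>Affine space and the Zariski topology\<close>

definition affine_space :: "'f::field itself \<Rightarrow> nat \<Rightarrow> (nat \<Rightarrow> 'f) set" where
  "affine_space _ n = {..<n} \<rightarrow>\<^sub>E UNIV"

definition vanishing_ideal :: "nat \<Rightarrow> (nat \<Rightarrow> 'f::field) set \<Rightarrow> 'f mpoly set" where
  "vanishing_ideal n S = {p \<in> mpoly_over UNIV {..<n}. \<forall>x\<in>S. meval x p = 0}"

definition zariski_closure :: "nat \<Rightarrow> (nat \<Rightarrow> 'f::field) set \<Rightarrow> (nat \<Rightarrow> 'f) set" where
  "zariski_closure n S =
     {x \<in> affine_space TYPE('f) n. \<forall>p\<in>vanishing_ideal n S. meval x p = 0}"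


section \<open>Hypercircles\<close>

definition param_image :: "nat \<Rightarrow> (nat \<Rightarrow> 'f::field poly fract) \<Rightarrow> (nat \<Rightarrow> 'f) set" where
  "param_image n \<phi> =
     {\<lambda>i\<in>{..<n}. rat_subst id (\<phi> i) t | t. \<forall>i<n. rat_defined id (\<phi> i) t}"

definition is_hypercircle ::
  "'f::field set \<Rightarrow> 'f \<Rightarrow> nat \<Rightarrow> 'f poly fract \<Rightarrow> (nat \<Rightarrow> 'f) set \<Rightarrow> bool" where
  "is_hypercircle K \<alpha> n u U \<longleftrightarrow>
     (\<exists>\<phi>. (\<forall>i<n. \<phi> i \<in> rat_over K) \<and>
          u = (\<Sum>i<n. \<phi> i * rat_const (\<alpha> ^ i)) \<and>
          U = zariski_closure n (param_image n \<phi>))"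

text \<open>
  A family of fractions \<open>r\<^sub>i / s\<close> over a common denominator is fixed only up to a common factor.
  If all \<open>r\<^sub>i\<close> and \<open>s\<close> share a factor vanishing on the whole curve, then \<open>1 = 0\<close> modulo
  \<open>s * Z - 1\<close> and the ideal of the curve, so the fractions cannot be used to describe the curve.
  The following condition excludes exactly this. It holds trivially for fractions in lowest terms
  (a constant common factor vanishes nowhere), but also for non-reduced representations whose
  denominator does not vanish identically on the curve.
\<close>

definition no_common_factor_vanishing_on ::
  "'f::field set \<Rightarrow> nat \<Rightarrow> (nat \<Rightarrow> 'f) set \<Rightarrow> (nat \<Rightarrow> 'f mpoly) \<Rightarrow> 'f mpoly \<Rightarrow> bool" where
  "no_common_factor_vanishing_on K n U r s \<longleftrightarrow>
     (\<forall>g\<in>mpoly_over K {..<n}. g dvd s \<longrightarrow> (\<forall>i<n. g dvd r i) \<longrightarrow> (\<exists>x\<in>U. meval x g \<noteq> 0))"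

lemma no_common_factor_vanishing_on_if_lowest_terms:
  assumes "s \<noteq> 0" and "U \<noteq> {}"
    and lowest: "\<And>g. g \<in> mpoly_over K {..<n} \<Longrightarrow> g dvd s \<Longrightarrow> \<forall>i<n. g dvd r i \<Longrightarrow> \<exists>c. g = mconst c"
  shows "no_common_factor_vanishing_on K n U r s"
  unfolding no_common_factor_vanishing_on_def
proof (intro ballI impI)
  fix g assume g: "g \<in> mpoly_over K {..<n}" "g dvd s" "\<forall>i<n. g dvd r i"
  then obtain c where c: "g = mconst c"
    using lowest by blast
  have "c \<noteq> 0"
    using g(2) \<open>s \<noteq> 0\<close> unfolding c mconst_def by auto
  then have "meval x g \<noteq> 0" for x
    unfolding c mconst_def meval_def by simp
  then show "\<exists>x\<in>U. meval x g \<noteq> 0"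
    using \<open>U \<noteq> {}\<close> by blast
qed

end

theory Submission
  imports Defs "Jordan_Normal_Form.Determinant"
begin

text \<open>
  Write \<open>X = \<Sum>\<^sub>i \<alpha>\<^sup>i X\<^sub>i\<close> and \<open>u(t) = (a t + b) / (c t + d)\<close>, so that the expansion of \<open>v(X)\<close> says
  \<open>(a - c X) \<Sum>\<^sub>i r\<^sub>i \<alpha>\<^sup>i = s (d X - b)\<close>. At the point of the curve with parameter \<open>t\<close> we have \<open>X = u(t)\<close>,
  hence \<open>\<Sum>\<^sub>i r\<^sub>i \<alpha>\<^sup>i = s t\<close>; comparing coefficients of the powers of \<open>\<alpha>\<close> gives \<open>r\<^sub>i = 0\<close> for \<open>i > 0\<close>.
  So the elimination ideal vanishes on the curve, provided that \<open>s\<close> does not.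

  Conversely, modulo the ideal \<open>T = r\<^sub>0 Z\<close> satisfies \<open>X = u(T)\<close>. The generators have coefficients
  in \<open>K\<close>, so coefficients of the powers of \<open>\<alpha>\<close> can be compared once more, which gives \<open>X\<^sub>i = \<phi>\<^sub>i(T)\<close>;
  the denominators are invertible by a Bezout identity in \<open>F[t]\<close>. Hence \<open>P\<close> is congruent to \<open>P(\<phi>(T))\<close>,
  which is \<open>0\<close> when \<open>P\<close> vanishes on the curve.

  It remains to see that \<open>s\<close> does not vanish on the curve. The form \<open>a - c X\<close> divides \<open>s\<close>, hence so do
  its conjugates and, being pairwise coprime primes, their product \<open>N\<close>. This norm has coefficients
  in \<open>K\<close> and no zero at the points of the parametrization, and \<open>s = N h\<close> with a common factor \<open>h\<close>
  of \<open>s\<close> and all \<open>r\<^sub>i\<close>, which is nonzero somewhere on the curve by assumption.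
\<close>

section \<open>Evaluation of multivariate polynomials\<close>

text \<open>Subrings are kept as bare subsets, so that one set of closure lemmas serves
  \<open>K\<close>, \<open>L\<close>, the whole field and the sets
  \<open>mpoly_over K V\<close>.\<close>

definition sring :: "'a::comm_ring_1 set \<Rightarrow> bool" where
  "sring K \<longleftrightarrow> 0 \<in> K \<and> 1 \<in> K \<and> (\<forall>x\<in>K. \<forall>y\<in>K. x + y \<in> K \<and> x * y \<in> K \<and> - x \<in> K)"

lemma sringD:
  assumes "sring K"
  shows "0 \<in> K" "1 \<in> K" "x \<in> K \<Longrightarrow> y \<in> K \<Longrightarrow> x + y \<in> K"
    "x \<in> K \<Longrightarrow> y \<in> K \<Longrightarrow> x * y \<in> K" "x \<in> K \<Longrightarrow> - x \<in> K"
    "x \<in> K \<Longrightarrow> y \<in> K \<Longrightarrow> x - y \<in> K"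
  using assms unfolding sring_def by (auto, metis diff_conv_add_uminus)

lemma sring_UNIV: "sring UNIV"
  by (auto simp: sring_def)

lemma sring_sum: "sring K \<Longrightarrow> (\<And>i. i \<in> A \<Longrightarrow> f i \<in> K) \<Longrightarrow> sum f A \<in> K"
  by (induction A rule: infinite_finite_induct) (auto intro: sringD)

lemma sring_power: "sring K \<Longrightarrow> x \<in> K \<Longrightarrow> x ^ k \<in> K"
  by (induction k) (auto intro: sringD)

definition monom_val :: "(nat \<Rightarrow> 'r::comm_semiring_1) \<Rightarrow> (nat \<Rightarrow>\<^sub>0 nat) \<Rightarrow> 'r" where
  "monom_val x m = (\<Prod>i\<in>Poly_Mapping.keys m. x i ^ Poly_Mapping.lookup m i)"

lemma monom_val_superset:
  assumes "finite S" "Poly_Mapping.keys m \<subseteq> S"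
  shows "monom_val x m = (\<Prod>i\<in>S. x i ^ Poly_Mapping.lookup m i)"
  unfolding monom_val_def by (rule prod.mono_neutral_left) (use assms in \<open>auto simp: in_keys_iff\<close>)

lemma monom_val_add: "monom_val x (m + m') = monom_val x m * monom_val x m'"
proof -
  let ?S = "Poly_Mapping.keys m \<union> Poly_Mapping.keys m'"
  have "monom_val x (m + m') = (\<Prod>i\<in>?S. x i ^ Poly_Mapping.lookup (m + m') i)"
    by (rule monom_val_superset) (auto simp: keys_add)
  also have "\<dots> = (\<Prod>i\<in>?S. x i ^ Poly_Mapping.lookup m i) * (\<Prod>i\<in>?S. x i ^ Poly_Mapping.lookup m' i)"
    by (simp add: lookup_add power_add prod.distrib)
  also have "\<dots> = monom_val x m * monom_val x m'"
    by (subst (1 2) monom_val_superset[where S = ?S]) auto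
  finally show ?thesis .
qed

lemma monom_val_zero [simp]: "monom_val x 0 = 1"
  by (simp add: monom_val_def)

lemma monom_val_single [simp]: "monom_val x (Poly_Mapping.single i k) = x i ^ k"
  by (cases "k = 0") (auto simp: monom_val_def)

text \<open>One evaluation map for two uses: \<open>h = id\<close> gives values at points,
  \<open>h = mconst\<close> gives substitutions inside the polynomial ring.\<close>

definition gev :: "('f::field \<Rightarrow> 'r::comm_ring_1) \<Rightarrow> (nat \<Rightarrow> 'r) \<Rightarrow> 'f mpoly \<Rightarrow> 'r" where
  "gev h x p = (\<Sum>m\<in>Poly_Mapping.keys p. h (Poly_Mapping.lookup p m) * monom_val x m)"

lemma meval_eq_gev: "meval x p = gev id x p"
  by (simp add: meval_def gev_def monom_val_def)

lemma mpoly_decomp: "p = (\<Sum>m\<in>Poly_Mapping.keys p. Poly_Mapping.single m (Poly_Mapping.lookup p m))"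
  by (rule poly_mapping_eqI) (auto simp: lookup_sum lookup_single when_def in_keys_iff)

locale coeff_hom = comm_ring_hom h for h :: "'f::field \<Rightarrow> 'r::comm_ring_1"
begin

lemma gev_superset:
  assumes "finite S" "Poly_Mapping.keys p \<subseteq> S"
  shows "gev h x p = (\<Sum>m\<in>S. h (Poly_Mapping.lookup p m) * monom_val x m)"
  unfolding gev_def by (rule sum.mono_neutral_left) (use assms in \<open>auto simp: in_keys_iff\<close>)

lemma gev_single: "gev h x (Poly_Mapping.single m c) = h c * monom_val x m"
  by (simp add: gev_def)

lemma gev_add: "gev h x (p + q) = gev h x p + gev h x q"
proof -
  let ?S = "Poly_Mapping.keys p \<union> Poly_Mapping.keys q"
  have "gev h x (p + q) = (\<Sum>m\<in>?S. h (Poly_Mapping.lookup (p + q) m) * monom_val x m)"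
    by (rule gev_superset) (auto simp: keys_add)
  also have "\<dots> = (\<Sum>m\<in>?S. h (Poly_Mapping.lookup p m) * monom_val x m)
      + (\<Sum>m\<in>?S. h (Poly_Mapping.lookup q m) * monom_val x m)"
    by (simp add: lookup_add hom_add ring_distribs sum.distrib)
  also have "\<dots> = gev h x p + gev h x q"
    by (subst (1 2) gev_superset[where S = ?S]) auto
  finally show ?thesis .
qed

lemma gev_zero: "gev h x 0 = 0"
  by (simp add: gev_def)

lemma gev_sum: "gev h x (sum f A) = (\<Sum>i\<in>A. gev h x (f i))"
  by (induction A rule: infinite_finite_induct) (auto simp: gev_zero gev_add)

lemma gev_mult: "gev h x (p * q) = gev h x p * gev h x q"
proof -
  have "p * q = (\<Sum>m\<in>Poly_Mapping.keys p. \<Sum>m'\<in>Poly_Mapping.keys q.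
      Poly_Mapping.single (m + m') (Poly_Mapping.lookup p m * Poly_Mapping.lookup q m'))"
    by (subst mpoly_decomp[of p], subst mpoly_decomp[of q])
       (simp add: sum_product mult_single)
  then have "gev h x (p * q) = (\<Sum>m\<in>Poly_Mapping.keys p. \<Sum>m'\<in>Poly_Mapping.keys q.
      (h (Poly_Mapping.lookup p m) * monom_val x m) * (h (Poly_Mapping.lookup q m') * monom_val x m'))"
    by (simp add: gev_sum gev_single monom_val_add hom_mult mult_ac)
  also have "\<dots> = gev h x p * gev h x q"
    by (simp add: gev_def sum_product)
  finally show ?thesis .
qed

lemma gev_one: "gev h x 1 = 1"
  using gev_single[of x 0 1] by simp

lemma gev_comm_ring_hom: "comm_ring_hom (gev h x)"
  by unfold_locales (auto simp: gev_add gev_mult gev_one gev_zero)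

lemma gev_mconst: "gev h x (mconst c) = h c"
  by (simp add: mconst_def gev_single)

lemma gev_mvar: "gev h x (mvar i) = x i"
  by (simp add: mvar_def gev_single)

end

lemma mconst_comm_ring_hom: "comm_ring_hom mconst"
  by unfold_locales (auto simp: mconst_def single_add mult_single)

lemma id_comm_ring_hom: "comm_ring_hom id"
  by unfold_locales auto

lemma mconst_0 [simp]: "mconst 0 = 0"
  and mconst_1 [simp]: "mconst 1 = 1"
  and mconst_add: "mconst (a + b) = mconst a + mconst b"
  and mconst_mult: "mconst (a * b) = mconst a * mconst b"
  and mconst_uminus: "mconst (- a) = - mconst a"
  and mconst_diff: "mconst (a - b) = mconst a - mconst b"
  by (simp_all add: mconst_def single_add mult_single single_uminus single_diff)

lemma mconst_power: "mconst (a ^ k) = mconst a ^ k"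
  by (induction k) (auto simp: mconst_mult)

lemma mconst_eq_iff [simp]: "mconst a = mconst b \<longleftrightarrow> a = b"
  using inj_single[of 0] by (auto simp: mconst_def inj_def)

lemma mconst_eq_0_iff [simp]: "mconst a = 0 \<longleftrightarrow> a = 0"
  using mconst_eq_iff[of a 0] by simp

lemma lookup_mconst_mult: "Poly_Mapping.lookup (mconst c * p) m = c * Poly_Mapping.lookup p m"
proof -
  have "mconst c * p = (\<Sum>k\<in>Poly_Mapping.keys p. Poly_Mapping.single k (c * Poly_Mapping.lookup p k))"
    by (subst mpoly_decomp[of p]) (simp add: mconst_def sum_distrib_left mult_single)
  then show ?thesis
    by (auto simp: lookup_sum lookup_single when_def in_keys_iff)
qed

lemma monom_val_mvar: "monom_val mvar m = (Poly_Mapping.single m 1 :: 'f::field mpoly)"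
proof -
  have pw: "(mvar i :: 'f mpoly) ^ k = Poly_Mapping.single (Poly_Mapping.single i k) 1" for i k
    by (induction k) (auto simp: mvar_def mult_single single_add[symmetric])
  have prd: "(\<Prod>i\<in>S. Poly_Mapping.single (Poly_Mapping.single i (f i)) (1::'f))
      = Poly_Mapping.single (\<Sum>i\<in>S. Poly_Mapping.single i (f i)) 1" for S and f :: "nat \<Rightarrow> nat"
    by (induction S rule: infinite_finite_induct) (auto simp: mult_single)
  have "m = (\<Sum>i\<in>Poly_Mapping.keys m. Poly_Mapping.single i (Poly_Mapping.lookup m i))"
    by (rule poly_mapping_eqI) (auto simp: lookup_sum lookup_single when_def in_keys_iff)
  then show ?thesis by (simp add: monom_val_def pw prd)
qed

text \<open>Presents \<open>p\<close> as its own value at the tuple of variables, so that it can be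
  compared with the result of another substitution.\<close>

lemma gev_mconst_mvar: "gev mconst mvar p = p"
  by (subst (2) mpoly_decomp) (simp add: gev_def monom_val_mvar mconst_def mult_single)

lemma gev_cong: "p \<in> mpoly_over K V \<Longrightarrow> (\<And>i. i \<in> V \<Longrightarrow> x i = y i) \<Longrightarrow> gev h x p = gev h y p"
  unfolding gev_def monom_val_def mpoly_over_def
  by (intro sum.cong prod.cong refl arg_cong2[where f = "(*)"] arg_cong2[where f = "(^)"]) auto

lemma mpoly_over_mono: "K \<subseteq> K' \<Longrightarrow> V \<subseteq> V' \<Longrightarrow> p \<in> mpoly_over K V \<Longrightarrow> p \<in> mpoly_over K' V'"
  unfolding mpoly_over_def by blast

lemma mpoly_over_lookup: "sring K \<Longrightarrow> p \<in> mpoly_over K V \<Longrightarrow> Poly_Mapping.lookup p m \<in> K"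
  by (cases "m \<in> Poly_Mapping.keys p") (auto simp: mpoly_over_def in_keys_iff sringD)

lemma mpoly_over_single: "c \<in> K \<Longrightarrow> Poly_Mapping.keys m \<subseteq> V \<Longrightarrow> Poly_Mapping.single m c \<in> mpoly_over K V"
  by (auto simp: mpoly_over_def)

lemma mpoly_over_0 [simp]: "0 \<in> mpoly_over K V"
  by (auto simp: mpoly_over_def)

context
  fixes K :: "'f::field set"
  assumes K: "sring K"
begin

lemma mpoly_over_mconst: "c \<in> K \<Longrightarrow> mconst c \<in> mpoly_over K V"
  unfolding mconst_def by (rule mpoly_over_single) auto

lemma mpoly_over_1: "1 \<in> mpoly_over K V"
  using mpoly_over_mconst[of 1] sringD(2)[OF K] by simp

lemma mpoly_over_mvar: "i \<in> V \<Longrightarrow> mvar i \<in> mpoly_over K V"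
  unfolding mvar_def by (rule mpoly_over_single) (auto intro: sringD K)

lemma mpoly_over_add:
  assumes "p \<in> mpoly_over K V" "q \<in> mpoly_over K V"
  shows "p + q \<in> mpoly_over K V"
  using assms keys_add[of p q] mpoly_over_lookup[OF K assms(1)] mpoly_over_lookup[OF K assms(2)]
  unfolding mpoly_over_def by (fastforce simp: lookup_add intro: sringD K)

lemma mpoly_over_sum: "(\<And>i. i \<in> A \<Longrightarrow> f i \<in> mpoly_over K V) \<Longrightarrow> sum f A \<in> mpoly_over K V"
  by (induction A rule: infinite_finite_induct) (auto intro: mpoly_over_add)

lemma mpoly_over_mult:
  assumes "p \<in> mpoly_over K V" "q \<in> mpoly_over K V"
  shows "p * q \<in> mpoly_over K V"
proof -
  have "p * q = (\<Sum>m\<in>Poly_Mapping.keys p. \<Sum>m'\<in>Poly_Mapping.keys q.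
      Poly_Mapping.single (m + m') (Poly_Mapping.lookup p m * Poly_Mapping.lookup q m'))"
    by (subst mpoly_decomp[of p], subst mpoly_decomp[of q])
       (simp add: sum_product mult_single)
  also have "\<dots> \<in> mpoly_over K V"
  proof (intro mpoly_over_sum mpoly_over_single)
    fix m m' assume m: "m \<in> Poly_Mapping.keys p" "m' \<in> Poly_Mapping.keys q"
    show "Poly_Mapping.lookup p m * Poly_Mapping.lookup q m' \<in> K"
      by (intro sringD(4) K mpoly_over_lookup[OF K assms(1)] mpoly_over_lookup[OF K assms(2)])
    show "Poly_Mapping.keys (m + m') \<subseteq> V"
      using m assms keys_add[of m m'] unfolding mpoly_over_def by blast
  qed
  finally show ?thesis .
qed

lemma mpoly_over_uminus:
  assumes "p \<in> mpoly_over K V"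
  shows "- p \<in> mpoly_over K V"
proof -
  have "- p = mconst (-1) * p" by (simp add: mconst_uminus)
  then show ?thesis using assms by (auto intro!: mpoly_over_mult mpoly_over_mconst sringD K)
qed

lemma mpoly_over_diff: "p \<in> mpoly_over K V \<Longrightarrow> q \<in> mpoly_over K V \<Longrightarrow> p - q \<in> mpoly_over K V"
  using mpoly_over_add[of p V "- q"] mpoly_over_uminus by simp

lemma mpoly_over_power: "p \<in> mpoly_over K V \<Longrightarrow> p ^ k \<in> mpoly_over K V"
  by (induction k) (auto intro: mpoly_over_mult mpoly_over_1)

lemma mpoly_over_prod: "(\<And>i. i \<in> A \<Longrightarrow> f i \<in> mpoly_over K V) \<Longrightarrow> prod f A \<in> mpoly_over K V"
  by (induction A rule: infinite_finite_induct) (auto intro: mpoly_over_mult mpoly_over_1)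

lemmas mpoly_over_closed = mpoly_over_mconst mpoly_over_1 mpoly_over_mvar mpoly_over_add
  mpoly_over_sum mpoly_over_mult mpoly_over_uminus mpoly_over_diff mpoly_over_power mpoly_over_prod

end

section \<open>Ideals relative to a subring, and congruences\<close>

definition ideal_over :: "'a::comm_ring_1 set \<Rightarrow> 'a set \<Rightarrow> bool" where
  "ideal_over W I \<longleftrightarrow> 0 \<in> I \<and> (\<forall>x\<in>I. \<forall>y\<in>I. x + y \<in> I) \<and> (\<forall>w\<in>W. \<forall>x\<in>I. w * x \<in> I)"

lemma ideal_overD:
  assumes "ideal_over W I"
  shows "0 \<in> I" "x \<in> I \<Longrightarrow> y \<in> I \<Longrightarrow> x + y \<in> I" "w \<in> W \<Longrightarrow> x \<in> I \<Longrightarrow> w * x \<in> I"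
  using assms unfolding ideal_over_def by auto

lemma ideal_over_sum: "ideal_over W I \<Longrightarrow> (\<And>i. i \<in> A \<Longrightarrow> f i \<in> I) \<Longrightarrow> sum f A \<in> I"
  by (induction A rule: infinite_finite_induct) (auto intro: ideal_overD)

lemma ideal_over_diff:
  assumes "ideal_over W I" "sring W" "x \<in> I" "y \<in> I"
  shows "x - y \<in> I"
proof -
  have "- 1 \<in> W" using assms(2) by (auto intro: sringD)
  then have "x + (- 1) * y \<in> I" using assms by (intro ideal_overD) auto
  then show ?thesis by simp
qed

lemma ideal_over_power_diff:
  assumes I: "ideal_over W I" and W: "sring W" and ab: "a \<in> W" "b \<in> W" "a - b \<in> I"
  shows "a ^ k - b ^ k \<in> I"
proof (induction k)
  case 0
  then show ?case using ideal_overD(1)[OF I] by simp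
next
  case (Suc k)
  have "a ^ Suc k - b ^ Suc k = a * (a ^ k - b ^ k) + b ^ k * (a - b)"
    by (simp add: algebra_simps)
  then show ?case using Suc ab by (auto intro!: ideal_overD[OF I] sring_power W)
qed

lemma ideal_over_monom_val_diff:
  assumes I: "ideal_over W I" and W: "sring W"
    and xy: "\<And>i. i \<in> Poly_Mapping.keys m \<Longrightarrow> x i \<in> W \<and> y i \<in> W \<and> x i - y i \<in> I"
  shows "monom_val x m - monom_val y m \<in> I"
proof -
  \<comment> \<open>The difference telescopes one variable at a time. The induction also carries
    membership in \<open>W\<close>, since the cofactors must lie in \<open>W\<close> to multiply
    elements of \<open>I\<close>.\<close>
  have "(\<Prod>i\<in>S. x i ^ f i) - (\<Prod>i\<in>S. y i ^ f i) \<in> I \<and> (\<Prod>i\<in>S. y i ^ f i) \<in> W"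
    if "S \<subseteq> Poly_Mapping.keys m" for S and f :: "nat \<Rightarrow> nat"
    using that
  proof (induction S rule: infinite_finite_induct)
    case (insert j S)
    have "(\<Prod>i\<in>insert j S. x i ^ f i) - (\<Prod>i\<in>insert j S. y i ^ f i)
      = x j ^ f j * ((\<Prod>i\<in>S. x i ^ f i) - (\<Prod>i\<in>S. y i ^ f i)) + (\<Prod>i\<in>S. y i ^ f i) * (x j ^ f j - y j ^ f j)"
      using insert(1,2) by (simp add: algebra_simps)
    moreover have "x j \<in> W" "y j \<in> W" "x j - y j \<in> I" using insert.prems xy[of j] by auto
    ultimately show ?case using insert
      by (auto intro!: ideal_overD[OF I] ideal_over_power_diff[OF I W] sring_power sringD(4)[OF W] W)
  qed (use ideal_overD(1)[OF I] sringD(2)[OF W] in auto)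
  then show ?thesis unfolding monom_val_def by blast
qed

text \<open>The multiples of \<open>d\<close> form an ideal, so congruent arguments give congruent
  monomials and hence congruent values.\<close>

lemma gev_dvd_diff:
  fixes h :: "'f::field \<Rightarrow> 'r::comm_ring_1"
  assumes "\<And>i. d dvd x i - y i"
  shows "d dvd gev h x p - gev h y p"
proof -
  have I: "ideal_over UNIV {z. d dvd z}" by (auto simp: ideal_over_def)
  have "d dvd monom_val x m - monom_val y m" for m
    using ideal_over_monom_val_diff[OF I sring_UNIV, of m x y] assms by simp
  then show ?thesis
    unfolding gev_def sum_subtractf[symmetric] right_diff_distrib[symmetric]
    by (intro dvd_sum dvd_mult)
qed

section \<open>Primitive extensions and conjugates\<close>

lemma type_ring_simps:
  fixes x y :: "'a::comm_ring_1"
  defines "R \<equiv> ring_of_type_algebra :: 'a ring"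
  shows "carrier R = UNIV" "x \<otimes>\<^bsub>R\<^esub> y = x * y" "x \<oplus>\<^bsub>R\<^esub> y = x + y" "\<one>\<^bsub>R\<^esub> = 1" "\<zero>\<^bsub>R\<^esub> = 0"
    "x [^]\<^bsub>R\<^esub> (k::nat) = x ^ k" "\<ominus>\<^bsub>R\<^esub> x = - x"
proof -
  interpret cring R unfolding R_def by (rule cring_from_type_algebra)
  show simps: "carrier R = UNIV" "x \<otimes>\<^bsub>R\<^esub> y = x * y" "x \<oplus>\<^bsub>R\<^esub> y = x + y" "\<one>\<^bsub>R\<^esub> = 1" "\<zero>\<^bsub>R\<^esub> = 0" for x y
    by (simp_all add: R_def ring_of_type_algebra_def)
  show "x [^]\<^bsub>R\<^esub> (k::nat) = x ^ k"
    by (induction k) (simp_all add: simps mult.commute)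
  show "\<ominus>\<^bsub>R\<^esub> x = - x"
    using minus_equality[of "- x" x] by (simp add: simps)
qed

lemma type_field_inv: "x \<noteq> 0 \<Longrightarrow> inv\<^bsub>field_of TYPE('f::field)\<^esub> x = inverse x"
proof -
  interpret field "field_of TYPE('f)" by (rule field_from_type_algebra)
  assume "x \<noteq> 0"
  then show ?thesis using comm_inv_char[of x "inverse x"] by (simp add: type_ring_simps)
qed

text \<open>What is used of the field extension, free of ring records: two subfields, the powers of
  \<alpha> below \<open>n\<close> as a basis of \<open>L\<close> over \<open>K\<close>, and roots
  for all nonconstant polynomials. Minimal polynomial and conjugates are recovered from
  these.\<close>

locale primitive_extension =
  fixes K L :: "'f::field_char_0 set" and \<alpha> :: 'f and n :: nat
  assumes sring_K: "sring K" and inverse_K: "x \<in> K \<Longrightarrow> inverse x \<in> K"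
    and sring_L: "sring L" and inverse_L: "x \<in> L \<Longrightarrow> inverse x \<in> L"
    and alpha_L: "\<alpha> \<in> L"
    and L_eq: "L = {\<Sum>i<n. k i * \<alpha> ^ i | k. \<forall>i<n. k i \<in> K}"
    and indep: "(\<And>i. i < n \<Longrightarrow> k i \<in> K) \<Longrightarrow> (\<Sum>i<n. k i * \<alpha> ^ i) = 0 \<Longrightarrow> i < n \<Longrightarrow> k i = 0"
    and alg_closed: "0 < Polynomial.degree p \<Longrightarrow> \<exists>x::'f. poly p x = 0"

lemma algebraically_closed_root:
  fixes p :: "'f::field poly"
  assumes "algebraically_closed (field_of TYPE('f))" and p: "0 < Polynomial.degree p"
  shows "\<exists>x. poly p x = 0"
proof -
  interpret algebraically_closed "field_of TYPE('f)" by fact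
  note [simp] = type_ring_simps[where 'a = 'f] type_field_inv[where 'f = 'f]
  \<comment> \<open>Here coefficient lists start with the leading coefficient, whereas
    \<open>coeffs\<close> starts with the constant term.\<close>
  define P where "P = rev (coeffs p)"
  have p0: "p \<noteq> 0" using p by auto
  have deg: "Polynomials.degree P = Polynomial.degree p"
    by (auto simp: P_def degree_eq_length_coeffs)
  have carrier_P: "P \<in> carrier (poly_ring (field_of TYPE('f)))"
    using p0 by (auto simp: univ_poly_def polynomial_def P_def hd_rev last_coeffs_eq_coeff_degree)
  then have "splitted P" by (rule roots_over_carrier)
  then have "roots P \<noteq> {#}"
    unfolding splitted_def using deg p by auto
  then obtain x where "x \<in># roots P" by blast
  then have x: "is_root P x"
    using roots_mem_iff_is_root[OF carrier_P] by auto
  have "eval xs x = poly (Poly (rev xs)) x" for xs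
    by (induction xs) (auto simp: Poly_append poly_monom)
  from this[of P] have "poly p x = 0"
    using x by (simp add: is_root_def P_def)
  then show ?thesis ..
qed

text \<open>As \<alpha> is algebraic over \<open>K\<close>, the field generated by it is the ring
  \<open>K[\<alpha>]\<close>. Its dimension is the degree of \<open>Irr K \<alpha>\<close>, so the
  powers of \<alpha> below \<open>n\<close> span it and are independent.\<close>

lemma primitive_extension_if_algebraic_closure:
  fixes K L :: "'f::field_char_0 set"
  assumes F: "algebraic_closure (field_of TYPE('f)) K"
    and L: "L = generate_field (field_of TYPE('f)) (insert \<alpha> K)"
    and dim: "ring.dimension (field_of TYPE('f)) n K L"
  shows "primitive_extension K L \<alpha> n"
proof -
  let ?F = "field_of TYPE('f)"
  note [simp] = type_ring_simps[where 'a = 'f] type_field_inv[where 'f = 'f]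
  interpret algebraic_closure ?F K by fact
  have K: "subfield K ?F" by (rule subfield_axioms)
  have sr: "sring H" if "subfield H ?F" for H
    using subringE(2,3,5,6,7)[OF subfieldE(1)[OF that]] by (auto simp: sring_def)
  have si: "inverse x \<in> H" if "subfield H ?F" "x \<in> H" for H x
    using subfield_m_inv(1)[OF that(1), of x] that sringD(1)[OF sr[OF that(1)]]
    by (cases "x = 0") auto
  have alg: "(algebraic over K) \<alpha>"
    by (rule algebraic_extension) simp
  have sub: "subfield (simple_extension K \<alpha>) ?F"
    using simple_extension_is_subfield[OF K] alg by simp
  have subL: "subfield L ?F"
    unfolding L by (rule generate_field_is_subfield) simp
  have inclL: "insert \<alpha> K \<subseteq> L"
    unfolding L by (auto intro: generate_field.incl)
  have "\<alpha> \<in> simple_extension K \<alpha>" "K \<subseteq> simple_extension K \<alpha>"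
    using simple_extension_mem[OF subfieldE(1)[OF K]] simple_extension_incl[OF subfieldE(3)[OF K]] by auto
  then have "L \<subseteq> simple_extension K \<alpha>"
    unfolding L by (intro generate_field_min_subfield1[OF _ sub]) auto
  moreover have "simple_extension K \<alpha> \<subseteq> L"
    using simple_extension_subring_incl[OF subfieldE(1)[OF subL], of K \<alpha>] inclL by auto
  ultimately have L_ext: "L = simple_extension K \<alpha>" by blast
  have n: "n = Polynomials.degree (Irr K \<alpha>)"
    using dimension_is_inj[OF K dim] dimension_simple_extension[OF K _ alg] L_ext by simp
  \<comment> \<open>\<open>exp_base\<close> lists the powers in descending order, hence the reversed
    coefficient list.\<close>
  have comb: "combine (rev (map k [0..<m])) (exp_base \<alpha> m) = (\<Sum>i<m. k i * \<alpha> ^ i)" for k m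
    by (induction m) (simp_all add: exp_base_def)
  show ?thesis
  proof
    show "sring K" by (rule sr[OF K])
    show "inverse x \<in> K" if "x \<in> K" for x by (rule si[OF K that])
    show "sring L" by (rule sr[OF subL])
    show "inverse x \<in> L" if "x \<in> L" for x by (rule si[OF subL that])
    show "\<alpha> \<in> L" using inclL by simp
    show "\<exists>x::'f. poly p x = 0" if "0 < Polynomial.degree p" for p
      using algebraically_closed_root[OF algebraically_closed_axioms that] .
    have ex: "\<exists>k. Ks = rev (map k [0..<n]) \<and> (\<forall>i<n. k i \<in> K)" if "length Ks = n" "set Ks \<subseteq> K" for Ks
    proof (intro exI conjI allI impI)
      show "Ks = rev (map (\<lambda>i. rev Ks ! i) [0..<n])"
        using that(1) by (metis length_rev map_nth rev_rev_ident)
      show "rev Ks ! i \<in> K" if "i < n" for i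
        using that \<open>length Ks = n\<close> \<open>set Ks \<subseteq> K\<close> nth_mem[of i "rev Ks"] by auto
    qed
    have lb: "length (exp_base \<alpha> n) = n" by (simp add: exp_base_def)
    have "L = Span K (exp_base \<alpha> n)"
      unfolding n L_ext using Span_exp_base[OF K _ alg] by simp
    also have "\<dots> = {combine Ks (exp_base \<alpha> n) | Ks. length Ks = n \<and> set Ks \<subseteq> K}"
      using Span_eq_combine_set_length_version[OF K, of "exp_base \<alpha> n"] lb by simp
    also have "\<dots> = {\<Sum>i<n. k i * \<alpha> ^ i | k. \<forall>i<n. k i \<in> K}"
    proof (intro equalityI subsetI)
      fix x assume "x \<in> {combine Ks (exp_base \<alpha> n) | Ks. length Ks = n \<and> set Ks \<subseteq> K}"
      then obtain Ks where Ks: "x = combine Ks (exp_base \<alpha> n)" "length Ks = n" "set Ks \<subseteq> K" by auto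
      from ex[OF this(2,3)] obtain k where "Ks = rev (map k [0..<n])" "\<forall>i<n. k i \<in> K" by auto
      with Ks(1) comb show "x \<in> {\<Sum>i<n. k i * \<alpha> ^ i | k. \<forall>i<n. k i \<in> K}" by auto
    next
      fix x assume "x \<in> {\<Sum>i<n. k i * \<alpha> ^ i | k. \<forall>i<n. k i \<in> K}"
      then obtain k where k: "x = (\<Sum>i<n. k i * \<alpha> ^ i)" "\<forall>i<n. k i \<in> K" by auto
      have "length (rev (map k [0..<n])) = n" "set (rev (map k [0..<n])) \<subseteq> K"
        using k(2) by auto
      with k(1) show "x \<in> {combine Ks (exp_base \<alpha> n) | Ks. length Ks = n \<and> set Ks \<subseteq> K}"
        unfolding comb[symmetric] by blast
    qed
    finally show "L = {\<Sum>i<n. k i * \<alpha> ^ i | k. \<forall>i<n. k i \<in> K}" .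
    fix k i assume k: "\<And>i. i < n \<Longrightarrow> k i \<in> K" "(\<Sum>i<n. k i * \<alpha> ^ i) = 0" "i < n"
    have "independent K (exp_base \<alpha> n)"
      unfolding n by (rule exp_base_independent[OF K _ alg]) simp
    from independent_imp_trivial_combine[OF K this, of "rev (map k [0..<n])"]
    have "set (rev (map k [0..<n])) \<subseteq> {0}"
      using k(1,2) comb lb by fastforce
    then show "k i = 0" using k(3) by (auto simp: image_subset_iff)
  qed
qed

section \<open>Univariate polynomials with coefficients in a subring\<close>

definition poly_over :: "'a::comm_ring_1 set \<Rightarrow> 'a poly set" where
  "poly_over K = {p. \<forall>i. poly.coeff p i \<in> K}"

lemma poly_over_iff_coeffs: "sring K \<Longrightarrow> p \<in> poly_over K \<longleftrightarrow> set (coeffs p) \<subseteq> K"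
proof -
  assume K: "sring K"
  have "p \<in> poly_over K \<longleftrightarrow> range (poly.coeff p) \<subseteq> K"
    by (auto simp: poly_over_def)
  then show ?thesis using sringD(1)[OF K] by (simp add: range_coeff)
qed

context
  fixes K :: "'a::comm_ring_1 set"
  assumes K: "sring K"
begin

lemma poly_over_0: "0 \<in> poly_over K"
  by (simp add: poly_over_def sringD[OF K])

lemma poly_over_add: "p \<in> poly_over K \<Longrightarrow> q \<in> poly_over K \<Longrightarrow> p + q \<in> poly_over K"
  by (simp add: poly_over_def sringD[OF K])

lemma poly_over_diff: "p \<in> poly_over K \<Longrightarrow> q \<in> poly_over K \<Longrightarrow> p - q \<in> poly_over K"
  by (simp add: poly_over_def sringD[OF K])

lemma poly_over_mult: "p \<in> poly_over K \<Longrightarrow> q \<in> poly_over K \<Longrightarrow> p * q \<in> poly_over K"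
  by (auto simp: poly_over_def coeff_mult intro!: sring_sum[OF K] sringD[OF K])

lemma poly_over_monom: "c \<in> K \<Longrightarrow> Polynomial.monom c k \<in> poly_over K"
  by (simp add: poly_over_def sringD[OF K])

lemma poly_over_sum: "(\<And>i. i \<in> A \<Longrightarrow> f i \<in> poly_over K) \<Longrightarrow> sum f A \<in> poly_over K"
  by (induction A rule: infinite_finite_induct) (auto intro: poly_over_add poly_over_0)

lemma poly_over_const: "c \<in> K \<Longrightarrow> [:c:] \<in> poly_over K"
  using poly_over_monom[of c 0] by (simp add: monom_0)

lemma poly_over_1: "1 \<in> poly_over K"
  using poly_over_const[of 1] sringD(2)[OF K] by (simp add: one_pCons)

lemma poly_over_power: "p \<in> poly_over K \<Longrightarrow> p ^ k \<in> poly_over K"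
  by (induction k) (auto intro: poly_over_mult poly_over_1)

lemma poly_over_prod: "(\<And>i. i \<in> A \<Longrightarrow> f i \<in> poly_over K) \<Longrightarrow> prod f A \<in> poly_over K"
  by (induction A rule: infinite_finite_induct) (auto intro: poly_over_mult poly_over_1)

end

lemma poly_over_pderiv:
  fixes K :: "'a::idom set"
  assumes K: "sring K" and "p \<in> poly_over K"
  shows "pderiv p \<in> poly_over K"
proof -
  have "of_nat k \<in> K" for k
    by (induction k) (auto intro: sringD K)
  then have "of_nat (Suc i) * poly.coeff p (Suc i) \<in> K" for i
    using assms(2) by (intro sringD(4)[OF K]) (auto simp: poly_over_def simp del: of_nat_Suc)
  then show ?thesis unfolding poly_over_def by (simp add: coeff_pderiv)
qed

text \<open>Long division inverts only the leading coefficient of \<open>g\<close>, so quotient and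
  remainder keep their coefficients in \<open>K\<close>.\<close>

lemma poly_over_division:
  fixes K :: "'f::field set"
  assumes K: "sring K" and inv: "\<And>x. x \<in> K \<Longrightarrow> inverse x \<in> K"
    and g: "g \<in> poly_over K" "g \<noteq> 0" and p: "p \<in> poly_over K"
  shows "\<exists>q\<in>poly_over K. \<exists>r\<in>poly_over K. p = q * g + r \<and> (r = 0 \<or> Polynomial.degree r < Polynomial.degree g)"
  using p
proof (induction "Polynomial.degree p" arbitrary: p rule: less_induct)
  case less
  consider "p = 0 \<or> Polynomial.degree p < Polynomial.degree g"
    | "p \<noteq> 0" "Polynomial.degree g \<le> Polynomial.degree p" by linarith
  then show ?case
  proof cases
    case 1
    then show ?thesis using less.prems by (intro bexI[of _ 0] bexI[of _ p]) (auto intro: poly_over_0 K)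
  next
    case 2
    define c where "c = Polynomial.lead_coeff p * inverse (Polynomial.lead_coeff g)"
    define M where "M = Polynomial.monom c (Polynomial.degree p - Polynomial.degree g)"
    have c: "c \<in> K" "c \<noteq> 0"
      using less.prems g 2 inv unfolding c_def poly_over_def by (auto intro!: sringD[OF K])
    have M: "M \<in> poly_over K" unfolding M_def by (rule poly_over_monom[OF K c(1)])
    have M0: "M \<noteq> 0" using c by (simp add: M_def)
    have degM: "Polynomial.degree (M * g) = Polynomial.degree p"
      using 2 M0 g c by (simp add: degree_mult_eq) (simp add: M_def degree_monom_eq)
    have lc: "poly.coeff (M * g) (Polynomial.degree p) = Polynomial.lead_coeff p"
    proof -
      have "Polynomial.lead_coeff (M * g) = c * Polynomial.lead_coeff g"
        unfolding lead_coeff_mult using c by (simp add: M_def degree_monom_eq)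
      then show ?thesis using degM g by (simp add: c_def)
    qed
    have p': "p - M * g \<in> poly_over K"
      by (intro poly_over_diff poly_over_mult less.prems M g K)
    have "\<exists>q\<in>poly_over K. \<exists>r\<in>poly_over K. p - M * g = q * g + r \<and> (r = 0 \<or> Polynomial.degree r < Polynomial.degree g)"
    proof (cases "p - M * g = 0")
      case True
      then show ?thesis by (intro bexI[of _ 0]) (auto intro: poly_over_0 K)
    next
      case False
      have "Polynomial.degree (p - M * g) \<le> Polynomial.degree p"
        using degM degree_diff_le_max[of p "M * g"] by simp
      moreover have "Polynomial.degree (p - M * g) \<noteq> Polynomial.degree p"
      proof
        assume eq: "Polynomial.degree (p - M * g) = Polynomial.degree p"
        have "poly.coeff (p - M * g) (Polynomial.degree p) = 0"
          using lc by simp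
        then show False using False eq by (metis leading_coeff_0_iff)
      qed
      ultimately show ?thesis using less.hyps[OF _ p'] by simp
    qed
    then obtain q r where "q \<in> poly_over K" "r \<in> poly_over K" "p - M * g = q * g + r"
      "r = 0 \<or> Polynomial.degree r < Polynomial.degree g" by blast
    then show ?thesis
      by (intro bexI[of _ "q + M"] bexI[of _ r]) (auto simp: algebra_simps intro: poly_over_add M K)
  qed
qed

text \<open>Split off a root. By the condition on the derivative it is not a root of the cofactor,
  so the number of roots and the degree drop by one together.\<close>

lemma card_roots_separable:
  fixes p :: "'f::field poly"
  assumes ac: "\<And>q::'f poly. 0 < Polynomial.degree q \<Longrightarrow> \<exists>x. poly q x = 0"
    and "p \<noteq> 0" and "\<And>x. poly p x = 0 \<Longrightarrow> poly (pderiv p) x \<noteq> 0"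
  shows "card {x. poly p x = 0} = Polynomial.degree p"
  using assms(2,3)
proof (induction "Polynomial.degree p" arbitrary: p)
  case 0
  then have "{x. poly p x = 0} = {}"
    by (auto elim!: degree_eq_zeroE dest!: sym[of 0])
  then show ?case using 0 by simp
next
  case (Suc d)
  obtain a where a: "poly p a = 0" using ac[of p] Suc.hyps(2) by auto
  then obtain q where q: "p = [:- a, 1:] * q"
    using poly_eq_0_iff_dvd[of p a] by (auto elim: dvdE)
  have q0: "q \<noteq> 0" using q Suc.prems by auto
  have d: "d = Polynomial.degree q"
    using Suc.hyps(2) q0 unfolding q by (subst (asm) degree_mult_eq) auto
  \<comment> \<open>At \<open>x = a\<close> this shows that \<open>q\<close> does not vanish at
    \<open>a\<close>; at the roots of \<open>q\<close> it passes the condition on the derivative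
    from \<open>p\<close> to \<open>q\<close>.\<close>
  have dp: "poly (pderiv p) x = (x - a) * poly (pderiv q) x + poly q x" for x
    unfolding q by (simp only: pderiv_mult poly_add poly_mult) (simp add: pderiv_pCons algebra_simps)
  have qa: "poly q a \<noteq> 0" using Suc.prems(2)[OF a] dp[of a] by simp
  have "card {x. poly q x = 0} = Polynomial.degree q"
  proof (rule Suc.hyps(1)[OF d q0])
    fix x assume "poly q x = 0"
    then show "poly (pderiv q) x \<noteq> 0"
      using Suc.prems(2)[of x] dp[of x] by (auto simp: q)
  qed
  moreover have "{x. poly p x = 0} = insert a {x. poly q x = 0}"
    by (auto simp: q)
  ultimately show ?case
    using qa d Suc.hyps(2) poly_roots_finite[OF q0] by simp
qed

section \<open>Minimal polynomial and conjugates of \<alpha>\<close>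

context primitive_extension
begin

lemma L_imp_poly:
  assumes "x \<in> L"
  obtains p where "p \<in> poly_over K" "poly p \<alpha> = x"
proof -
  from assms obtain k where k: "x = (\<Sum>i<n. k i * \<alpha> ^ i)" "\<forall>i<n. k i \<in> K"
    unfolding L_eq by auto
  show ?thesis
    by (rule that[of "\<Sum>i<n. Polynomial.monom (k i) i"])
       (use k in \<open>auto simp: poly_sum poly_monom intro!: poly_over_sum poly_over_monom sring_K\<close>)
qed

text \<open>Independence of the powers of \<alpha>, read as a statement about polynomials; it takes
  the place of irreducibility of the minimal polynomial.\<close>

lemma poly_over_root_small_degree:
  assumes p: "p \<in> poly_over K" "poly p \<alpha> = 0" and deg: "Polynomial.degree p < n"
  shows "p = 0"
proof -
  have *: "poly p \<alpha> = (\<Sum>i<n. poly.coeff p i * \<alpha> ^ i)"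
    unfolding poly_altdef by (rule sum.mono_neutral_left) (use deg in \<open>auto simp: coeff_eq_0\<close>)
  have "poly.coeff p i = 0" if "i < n" for i
    by (rule indep[where k = "poly.coeff p"]) (use p * that in \<open>auto simp: poly_over_def\<close>)
  then show ?thesis
    using deg by (intro poly_eqI) (metis coeff_0 coeff_eq_0 le_less_trans not_le)
qed

lemma n_pos: "0 < n"
proof (rule ccontr)
  assume "\<not> 0 < n"
  then have "L = {0}" unfolding L_eq by auto
  then show False using sringD(2)[OF sring_L] by simp
qed

lemma minimal_polynomial:
  obtains m where "m \<in> poly_over K" "Polynomial.degree m = n" "poly m \<alpha> = 0"
proof -
  have "\<alpha> ^ n \<in> L" by (intro sring_power sring_L alpha_L)
  then obtain k where k: "\<alpha> ^ n = (\<Sum>i<n. k i * \<alpha> ^ i)" "\<forall>i<n. k i \<in> K"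
    unfolding L_eq by auto
  define m where "m = Polynomial.monom 1 n - (\<Sum>i<n. Polynomial.monom (k i) i)"
  have "m \<in> poly_over K"
    unfolding m_def using k(2)
    by (auto intro!: poly_over_diff poly_over_sum poly_over_monom sring_K sringD(2)[OF sring_K])
  moreover have "poly m \<alpha> = 0"
    by (simp add: m_def poly_sum poly_monom k(1))
  moreover have "Polynomial.degree m = n"
  proof (rule order.antisym)
    show "Polynomial.degree m \<le> n"
      by (rule degree_le) (auto simp: m_def coeff_sum)
    show "n \<le> Polynomial.degree m"
      by (rule le_degree) (auto simp: m_def coeff_sum)
  qed
  ultimately show ?thesis by (metis that)
qed

text \<open>The roots of the minimal polynomial, described without it: this form lets any relation
  of \<alpha> over \<open>K\<close> be carried over to \<beta> at once.\<close>

definition conjugates :: "'f set" where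
  "conjugates = {\<beta>. \<forall>p\<in>poly_over K. poly p \<alpha> = 0 \<longrightarrow> poly p \<beta> = 0}"

text \<open>In characteristic zero the minimal polynomial \<open>m\<close> is separable, so it has
  \<open>n\<close> distinct roots. Division by \<open>m\<close> shows that every polynomial over
  \<open>K\<close> vanishing at \<alpha> is a multiple of \<open>m\<close>, hence vanishes at all of
  them.\<close>

lemma card_conjugates:
  obtains B where "B \<subseteq> conjugates" "\<alpha> \<in> B" "finite B" "card B = n"
proof -
  obtain m where m: "m \<in> poly_over K" "Polynomial.degree m = n" "poly m \<alpha> = 0"
    by (rule minimal_polynomial)
  have m0: "m \<noteq> 0" using m n_pos by auto
  note division = poly_over_division[OF sring_K inverse_K]
  have sep: "poly (pderiv m) \<beta> \<noteq> 0" if \<beta>: "poly m \<beta> = 0" for \<beta>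
  proof
    assume d0: "poly (pderiv m) \<beta> = 0"
    let ?P = "\<lambda>g. g \<in> poly_over K \<and> g \<noteq> 0 \<and> poly g \<beta> = 0"
    \<comment> \<open>Characteristic zero enters here.\<close>
    have dm0: "pderiv m \<noteq> 0" using m n_pos by (simp add: pderiv_eq_0_iff)
    have Pd: "?P (pderiv m)" using d0 dm0 poly_over_pderiv[OF sring_K m(1)] by auto
    \<comment> \<open>A polynomial \<open>g\<close> over \<open>K\<close> of least degree vanishing
      at \<beta> divides \<open>m\<close>. Its degree is positive and, because of the derivative,
      below \<open>n\<close>; so \<open>m\<close> is a product of two factors of degree below
      \<open>n\<close>, one of which vanishes at \<alpha>.\<close>
    then have "\<exists>g. ?P g \<and> (\<forall>h. ?P h \<longrightarrow> Polynomial.degree g \<le> Polynomial.degree h)"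
      by (rule ex_has_least_nat)
    then obtain g where g: "?P g" and min: "\<And>h. ?P h \<Longrightarrow> Polynomial.degree g \<le> Polynomial.degree h"
      by blast
    have "Polynomial.degree g < n"
      using min[OF Pd] n_pos m(2) by (simp add: degree_pderiv)
    obtain q r where qr: "q \<in> poly_over K" "r \<in> poly_over K" "m = q * g + r"
      "r = 0 \<or> Polynomial.degree r < Polynomial.degree g"
      using division[of g m] g m by blast
    have "poly r \<beta> = 0" using qr(3) \<beta> g by (simp add: qr(3))
    then have "r = 0" using min[of r] qr(2,4) by (metis not_le)
    then have mq: "m = q * g" using qr by simp
    have q0: "q \<noteq> 0" using mq m0 by auto
    have "0 < Polynomial.degree g"
      using g by (intro gr0I) (auto elim!: degree_eq_zeroE)
    moreover have "n = Polynomial.degree q + Polynomial.degree g"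
      using m(2) mq q0 g by (simp add: degree_mult_eq)
    ultimately have "Polynomial.degree q < n" by simp
    have "poly q \<alpha> = 0 \<or> poly g \<alpha> = 0" using m(3) mq by simp
    then show False
      using poly_over_root_small_degree[of q] poly_over_root_small_degree[of g] q0 g qr
        \<open>Polynomial.degree q < n\<close> \<open>Polynomial.degree g < n\<close> by auto
  qed
  show ?thesis
  proof (rule that[of "{x. poly m x = 0}"])
    show "\<alpha> \<in> {x. poly m x = 0}" using m(3) by simp
    show "finite {x. poly m x = 0}" by (rule poly_roots_finite[OF m0])
    show "card {x. poly m x = 0} = n"
      using card_roots_separable[OF alg_closed m0 sep] m(2) by simp
    show "{x. poly m x = 0} \<subseteq> conjugates"
    proof (intro subsetI)
      fix \<beta> assume "\<beta> \<in> {x. poly m x = 0}"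
      then have \<beta>: "poly m \<beta> = 0" by simp
      show "\<beta> \<in> conjugates"
        unfolding conjugates_def
      proof (intro CollectI ballI impI)
        fix p assume p: "p \<in> poly_over K" "poly p \<alpha> = 0"
        obtain q r where qr: "q \<in> poly_over K" "r \<in> poly_over K" "p = q * m + r"
          "r = 0 \<or> Polynomial.degree r < Polynomial.degree m"
          using division[of m p] p m m0 by blast
        have "poly r \<alpha> = 0" using qr(3) p m by simp
        then have "r = 0" using poly_over_root_small_degree[of r] qr(2,4) m(2) by auto
        then show "poly p \<beta> = 0" using qr(3) \<beta> by simp
      qed
    qed
  qed
qed

end

section \<open>Linear forms and their norms\<close>

lemma sring_mpoly_over: "sring K \<Longrightarrow> sring (mpoly_over K V)"
  unfolding sring_def[of "mpoly_over K V"] by (auto intro: mpoly_over_closed)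

lemma (in comm_ring_hom) poly_map_poly_hom: "poly (map_poly hom p) (hom x) = hom (poly p x)"
  by (induction p) (auto simp: map_poly_pCons hom_add hom_mult)

lemma poly_map_poly_mconst: "poly (map_poly mconst p) (mconst x) = mconst (poly p x)"
  by (rule comm_ring_hom.poly_map_poly_hom[OF mconst_comm_ring_hom])

lemma map_poly_mconst_over: "sring K \<Longrightarrow> p \<in> poly_over K \<Longrightarrow> map_poly mconst p \<in> poly_over (mpoly_over K V)"
  by (auto simp: poly_over_def coeff_map_poly intro: mpoly_over_mconst)

definition generic_elt :: "nat \<Rightarrow> 'f::field \<Rightarrow> 'f mpoly" where
  "generic_elt n \<beta> = (\<Sum>i<n. mconst (\<beta> ^ i) * mvar i)"

text \<open>The generic element with \<alpha> replaced by an indeterminate. Its coefficients are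
  over \<open>K\<close>, so identities in \<alpha> become polynomials that can be evaluated at any
  conjugate.\<close>

definition generic_poly :: "nat \<Rightarrow> 'f::field mpoly poly" where
  "generic_poly n = (\<Sum>i<n. Polynomial.monom (mvar i) i)"

lemma poly_generic_poly: "poly (generic_poly n) (mconst \<beta>) = generic_elt n \<beta>"
  by (simp add: generic_poly_def generic_elt_def poly_sum poly_monom mconst_power mult_ac)

lemma generic_poly_over: "sring K \<Longrightarrow> {..<n} \<subseteq> V \<Longrightarrow> generic_poly n \<in> poly_over (mpoly_over K V)"
  unfolding generic_poly_def
  by (intro poly_over_sum poly_over_monom sring_mpoly_over mpoly_over_mvar) auto

lemma generic_elt_over: "sring K \<Longrightarrow> \<beta> \<in> K \<Longrightarrow> {..<n} \<subseteq> V \<Longrightarrow> generic_elt n \<beta> \<in> mpoly_over K V"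
  unfolding generic_elt_def by (auto intro!: mpoly_over_closed sring_power)

lemma lookup_generic_elt:
  "j < n \<Longrightarrow> Poly_Mapping.lookup (generic_elt n \<beta>) (Poly_Mapping.single j (Suc 0)) = \<beta> ^ j"
proof -
  assume "j < n"
  have "Poly_Mapping.lookup (mvar i :: 'a mpoly) (Poly_Mapping.single j (Suc 0)) = (if i = j then 1 else 0)" for i
    unfolding mvar_def lookup_single when_def One_nat_def
    by (metis keys_single singleton_inject zero_neq_one One_nat_def)
  then show ?thesis
    using \<open>j < n\<close> by (simp add: generic_elt_def lookup_sum lookup_mconst_mult if_distrib[of "\<lambda>z. _ * z"] cong: if_cong)
qed

text \<open>The denominator \<open>a - c X\<close> of the inverse of the unit at the generic
  element; conjugating \<open>a\<close>, \<open>c\<close> and \<alpha> together gives its conjugate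
  forms.\<close>

definition linear_form :: "nat \<Rightarrow> 'f::field \<Rightarrow> 'f \<Rightarrow> 'f \<Rightarrow> 'f mpoly" where
  "linear_form n a c \<beta> = mconst a - mconst c * generic_elt n \<beta>"

lemma lookup_linear_form:
  "j < n \<Longrightarrow> Poly_Mapping.lookup (linear_form n a c \<beta>) (Poly_Mapping.single j (Suc 0)) = - c * \<beta> ^ j"
proof -
  have "Poly_Mapping.single j (Suc 0) \<noteq> 0" by (metis keys_single keys_zero insert_not_empty nat.distinct(1))
  then have "Poly_Mapping.lookup (mconst a) (Poly_Mapping.single j (Suc 0)) = 0"
    by (simp add: mconst_def lookup_single when_def)
  then show "j < n \<Longrightarrow> ?thesis"
    by (simp add: linear_form_def lookup_minus lookup_mconst_mult lookup_generic_elt)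
qed

text \<open>
  The linear forms with \<open>c \<beta> \<noteq> 0\<close> are prime: substituting for \<open>X\<^sub>0\<close> identifies the
  multiples of such a form with the kernel of a homomorphism into a domain.
\<close>

lemma linear_form_dvd_iff:
  fixes a c \<beta> :: "'f::field"
  assumes "0 < n" "c \<noteq> 0"
  defines "f \<equiv> linear_form n a c \<beta>"
  shows "\<exists>\<pi> :: 'f mpoly \<Rightarrow> 'f mpoly. comm_ring_hom \<pi> \<and> (\<forall>p. f dvd p \<longleftrightarrow> \<pi> p = 0)
    \<and> (\<forall>a' c' \<beta>'. \<pi> (linear_form n a' c' \<beta>') = linear_form n a' c' \<beta>' - mconst (c' / c) * f)"
proof -
  interpret coeff_hom "mconst :: 'f \<Rightarrow> 'f mpoly"
    by (simp add: coeff_hom_def mconst_comm_ring_hom)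
  \<comment> \<open>\<open>X_0\<close> occurs in \<open>f\<close> with coefficient
    \<open>- c\<close>, so adding \<open>f / c\<close> to \<open>X_0\<close> sends \<open>f\<close>
    to \<open>0\<close>.\<close>
  define x :: "nat \<Rightarrow> 'f mpoly" where "x = (\<lambda>i. if i = 0 then mvar 0 + mconst (1 / c) * f else mvar i)"
  define \<pi> where "\<pi> = gev mconst x"
  interpret \<pi>: comm_ring_hom \<pi> unfolding \<pi>_def by (rule gev_comm_ring_hom)
  have pi_mconst: "\<pi> (mconst d) = mconst d" for d by (simp add: \<pi>_def gev_mconst)
  have pi_gen: "\<pi> (generic_elt n \<beta>') = generic_elt n \<beta>' + mconst (1 / c) * f" for \<beta>'
  proof -
    have "\<pi> (generic_elt n \<beta>') = (\<Sum>i<n. mconst (\<beta>' ^ i) * x i)"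
      by (simp add: generic_elt_def \<pi>.hom_sum \<pi>.hom_mult pi_mconst) (simp add: \<pi>_def gev_mvar)
    also have "\<dots> = (\<Sum>i<n. mconst (\<beta>' ^ i) * mvar i + (if i = 0 then mconst (1 / c) * f else 0))"
      by (intro sum.cong refl) (auto simp: x_def algebra_simps)
    also have "\<dots> = generic_elt n \<beta>' + mconst (1 / c) * f"
      using \<open>0 < n\<close> by (simp add: sum.distrib generic_elt_def)
    finally show ?thesis .
  qed
  have lf: "\<pi> (linear_form n a' c' \<beta>') = linear_form n a' c' \<beta>' - mconst (c' / c) * f" for a' c' \<beta>'
  proof -
    have "mconst c' * (mconst (1 / c) * f) = mconst (c' / c) * f"
      unfolding mult.assoc[symmetric] mconst_mult[symmetric] by simp
    then show ?thesis
      unfolding linear_form_def \<pi>.hom_minus \<pi>.hom_mult pi_mconst pi_gen distrib_left by simp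
  qed
  have pf: "\<pi> f = 0"
    using lf[of a c \<beta>] \<open>c \<noteq> 0\<close> by (simp add: f_def)
  have "f dvd p \<longleftrightarrow> \<pi> p = 0" for p
  proof
    assume "f dvd p"
    then show "\<pi> p = 0" using pf by (auto elim!: dvdE simp: \<pi>.hom_mult)
  next
    assume "\<pi> p = 0"
    \<comment> \<open>The substitution moves each variable by a multiple of \<open>f\<close>, so it
      does not change \<open>p\<close> modulo \<open>f\<close>.\<close>
    moreover have "f dvd gev mconst mvar p - gev mconst x p"
      by (rule gev_dvd_diff) (simp add: x_def)
    ultimately show "f dvd p" by (simp add: gev_mconst_mvar \<pi>_def)
  qed
  with lf show ?thesis using \<pi>.comm_ring_hom_axioms by blast
qed

text \<open>Induction on \<open>B\<close>: the new form is prime and divides none of the earlier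
  ones, so it divides the cofactor of their product in \<open>s\<close>.\<close>

lemma prod_linear_forms_dvd:
  fixes a c :: "'f::field \<Rightarrow> 'f"
  assumes B: "finite B" "card B \<le> n" and c: "\<And>\<beta>. \<beta> \<in> B \<Longrightarrow> c \<beta> \<noteq> 0"
    and dvd: "\<And>\<beta>. \<beta> \<in> B \<Longrightarrow> linear_form n (a \<beta>) (c \<beta>) \<beta> dvd s"
  shows "(\<Prod>\<beta>\<in>B. linear_form n (a \<beta>) (c \<beta>) \<beta>) dvd s"
  using assms
proof (induction B rule: finite_induct)
  case (insert \<gamma> B)
  let ?f = "\<lambda>\<beta>. linear_form n (a \<beta>) (c \<beta>) \<beta>"
  have n: "0 < n" using insert.prems(1) insert.hyps by simp
  obtain \<pi> :: "'f mpoly \<Rightarrow> 'f mpoly" where \<pi>: "comm_ring_hom \<pi>" "\<And>p. ?f \<gamma> dvd p \<longleftrightarrow> \<pi> p = 0"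
    "\<And>a' c' \<beta>'. \<pi> (linear_form n a' c' \<beta>') = linear_form n a' c' \<beta>' - mconst (c' / c \<gamma>) * ?f \<gamma>"
    using linear_form_dvd_iff[OF n insert.prems(2)[of \<gamma>], of "a \<gamma>" \<gamma>] by auto
  interpret \<pi>: comm_ring_hom \<pi> by fact
  have "(\<Prod>\<beta>\<in>B. ?f \<beta>) dvd s"
    using insert by simp
  then obtain w where w: "s = (\<Prod>\<beta>\<in>B. ?f \<beta>) * w" by (elim dvdE)
  have nz: "\<pi> (?f \<beta>) \<noteq> 0" if "\<beta> \<in> B" for \<beta>
  proof
    assume "\<pi> (?f \<beta>) = 0"
    \<comment> \<open>The two forms would be proportional with ratio
      \<open>c \<beta> / c \<gamma>\<close>, and comparing the coefficients of \<open>X_1\<close>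
      would give \<beta> = \<gamma>. The variable \<open>X_1\<close> is among those of the forms,
      because two distinct elements force \<open>n > 1\<close>.\<close>
    then have "Poly_Mapping.lookup (?f \<beta>) (Poly_Mapping.single 1 (Suc 0))
        = Poly_Mapping.lookup (mconst (c \<beta> / c \<gamma>) * ?f \<gamma>) (Poly_Mapping.single 1 (Suc 0))"
      unfolding \<pi>(3) by simp
    moreover have "1 < n"
      using that insert.hyps insert.prems(1) card_gt_0_iff[of B] by fastforce
    moreover have "\<beta> \<noteq> \<gamma>" using that insert.hyps by auto
    ultimately show False
      using insert.prems(2)[of \<beta>] insert.prems(2)[of \<gamma>] that
      by (simp only: lookup_mconst_mult lookup_linear_form[of 1]) simp
  qed
  have "\<pi> s = 0" using insert.prems(3)[of \<gamma>] \<pi>(2) by simp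
  then have "\<pi> w = 0"
    using nz insert.hyps(1) by (auto simp: w \<pi>.hom_mult \<pi>.hom_prod)
  then have "?f \<gamma> dvd w" using \<pi>(2) by simp
  then show ?case using w insert.hyps by (auto elim!: dvdE simp: mult_ac)
qed simp

text \<open>The order on exponents is linear and compatible with addition, so \<open>a + b\<close>
  is the sum of no other pair of exponents of \<open>p\<close> and \<open>q\<close>.\<close>

lemma lookup_times_extremal:
  fixes p q :: "'f::field mpoly"
  assumes "\<And>m. m \<in> Poly_Mapping.keys p \<Longrightarrow> m \<le> a" "\<And>m. m \<in> Poly_Mapping.keys q \<Longrightarrow> m \<le> b"
  shows "Poly_Mapping.lookup (p * q) (a + b) = Poly_Mapping.lookup p a * Poly_Mapping.lookup q b"
proof -
  have eq: "m = a \<and> m' = b" if "m \<in> Poly_Mapping.keys p" "m' \<in> Poly_Mapping.keys q" "m + m' = a + b" for m m'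
    using assms(1)[OF that(1)] assms(2)[OF that(2)] that(3) add_less_le_mono[of m a m' b] add_le_less_mono[of m a m' b]
    by (auto simp: le_less)
  have "p * q = (\<Sum>m\<in>Poly_Mapping.keys p. \<Sum>m'\<in>Poly_Mapping.keys q.
      Poly_Mapping.single (m + m') (Poly_Mapping.lookup p m * Poly_Mapping.lookup q m'))"
    by (subst mpoly_decomp[of p], subst mpoly_decomp[of q])
       (simp add: sum_product mult_single)
  then have "Poly_Mapping.lookup (p * q) (a + b) = (\<Sum>m\<in>Poly_Mapping.keys p. \<Sum>m'\<in>Poly_Mapping.keys q.
      if m = a \<and> m' = b then Poly_Mapping.lookup p m * Poly_Mapping.lookup q m' else 0)"
    using eq by (auto simp: lookup_sum lookup_single when_def intro!: sum.cong)
  also have "\<dots> = (\<Sum>m\<in>Poly_Mapping.keys p. if m = a then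
      (\<Sum>m'\<in>Poly_Mapping.keys q. if m' = b then Poly_Mapping.lookup p m * Poly_Mapping.lookup q m' else 0) else 0)"
    by (intro sum.cong refl) auto
  also have "\<dots> = Poly_Mapping.lookup p a * Poly_Mapping.lookup q b"
    by (auto simp: in_keys_iff)
  finally show ?thesis .
qed

text \<open>Setting the variables outside \<open>V\<close> to zero fixes \<open>N\<close> and
  \<open>s\<close>; cancelling \<open>N\<close>, it fixes \<open>h\<close> too.\<close>

lemma mpoly_over_quotient_vars:
  fixes h :: "'f::field mpoly"
  assumes N: "N \<in> mpoly_over UNIV V" and s: "s \<in> mpoly_over UNIV V" and eq: "s = N * h" and "N \<noteq> 0"
  shows "h \<in> mpoly_over UNIV V"
proof -
  interpret coeff_hom "mconst :: 'f \<Rightarrow> 'f mpoly"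
    by (simp add: coeff_hom_def mconst_comm_ring_hom)
  define x where "x i = (if i \<in> V then mvar i else 0 :: 'f mpoly)" for i
  have fix_p: "gev mconst x p = p" if "p \<in> mpoly_over UNIV V" for p
    using gev_cong[OF that, of x mvar mconst] by (simp add: x_def gev_mconst_mvar)
  have "N * h = N * gev mconst x h"
    using fix_p[OF s] unfolding eq gev_mult fix_p[OF N] by (rule sym)
  then have "gev mconst x h = h" using \<open>N \<noteq> 0\<close> by simp
  moreover have "gev mconst x h \<in> mpoly_over UNIV V"
    unfolding gev_def monom_val_def
    by (auto intro!: mpoly_over_closed sring_UNIV simp: x_def)
  ultimately show ?thesis by simp
qed

text \<open>Split \<open>h = h1 + h2\<close>, where \<open>h2\<close> has the terms with
  coefficients outside \<open>K\<close>. If \<open>h2\<close> were nonzero, the leading coefficient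
  of \<open>N * h2 = s - N * h1\<close> would lie in \<open>K\<close>, yet it is a nonzero element
  of \<open>K\<close> times an element outside \<open>K\<close>.\<close>

lemma mpoly_over_quotient:
  fixes K :: "'f::field set"
  assumes K: "sring K" and inv: "\<And>x. x \<in> K \<Longrightarrow> inverse x \<in> K"
    and N: "N \<in> mpoly_over K V" and s: "s \<in> mpoly_over K V" and eq: "s = N * h" and "N \<noteq> 0"
  shows "h \<in> mpoly_over K V"
proof -
  let ?lk = Poly_Mapping.lookup and ?keys = Poly_Mapping.keys
  have hV: "h \<in> mpoly_over UNIV V"
    by (rule mpoly_over_quotient_vars[OF _ _ eq \<open>N \<noteq> 0\<close>]) (use N s in \<open>auto intro: mpoly_over_mono[of K UNIV V V]\<close>)
  define bad where "bad = {m \<in> ?keys h. ?lk h m \<notin> K}"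
  define h1 where "h1 = (\<Sum>m\<in>?keys h - bad. Poly_Mapping.single m (?lk h m))"
  define h2 where "h2 = (\<Sum>m\<in>bad. Poly_Mapping.single m (?lk h m))"
  have "bad \<subseteq> ?keys h" by (auto simp: bad_def)
  then have h: "h = h1 + h2"
    unfolding h1_def h2_def by (subst mpoly_decomp) (simp add: sum.subset_diff)
  have "bad = {}"
  proof (rule ccontr)
    assume "bad \<noteq> {}"
    have fin: "finite bad" by (simp add: bad_def)
    define a where "a = Max (?keys N)"
    define b where "b = Max bad"
    have lk2: "?lk h2 m = (if m \<in> bad then ?lk h m else 0)" for m
      using fin by (auto simp: h2_def lookup_sum lookup_single when_def)
    have keys2: "?keys h2 \<subseteq> bad"
      using lk2 by (auto simp: in_keys_iff split: if_splits)
    have kN: "?keys N \<noteq> {}" using \<open>N \<noteq> 0\<close> by simp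
    have a: "a \<in> ?keys N" unfolding a_def by (rule Max_in) (use kN in auto)
    have b: "b \<in> bad" unfolding b_def by (rule Max_in[OF fin \<open>bad \<noteq> {}\<close>])
    have "?lk (N * h2) (a + b) = ?lk N a * ?lk h2 b"
      by (rule lookup_times_extremal) (use keys2 fin in \<open>auto simp: a_def b_def\<close>)
    moreover have "N * h2 = s - N * h1" unfolding eq h by (simp add: algebra_simps)
    moreover have "s - N * h1 \<in> mpoly_over K V"
      unfolding h1_def using hV
      by (intro mpoly_over_closed K s N mpoly_over_single) (auto simp: bad_def mpoly_over_def)
    ultimately have "?lk N a * ?lk h b \<in> K"
      using mpoly_over_lookup[OF K] b lk2[of b] by metis
    moreover have Na: "?lk N a \<in> K" "?lk N a \<noteq> 0"
      using mpoly_over_lookup[OF K N] a by (auto simp: in_keys_iff)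
    ultimately have "inverse (?lk N a) * (?lk N a * ?lk h b) \<in> K"
      using sringD(4)[OF K inv] by blast
    moreover have "inverse (?lk N a) * (?lk N a * ?lk h b) = ?lk h b"
      using Na by (simp add: field_simps)
    ultimately show False using b by (simp add: bad_def)
  qed
  then show ?thesis using hV by (auto simp: bad_def mpoly_over_def)
qed

section \<open>Expansions in powers of \<alpha>, and transfer to conjugates\<close>

context primitive_extension
begin

lemma mpoly_indep:
  assumes "\<And>i. i < n \<Longrightarrow> g i \<in> mpoly_over K V" "(\<Sum>i<n. mconst (\<alpha> ^ i) * g i) = 0" "i < n"
  shows "g i = 0"
proof (rule poly_mapping_eqI)
  fix m
  have "(\<Sum>i<n. Poly_Mapping.lookup (g i) m * \<alpha> ^ i) = Poly_Mapping.lookup (\<Sum>i<n. mconst (\<alpha> ^ i) * g i) m"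
    by (simp only: lookup_sum lookup_mconst_mult) (simp add: mult.commute)
  then have "(\<Sum>i<n. Poly_Mapping.lookup (g i) m * \<alpha> ^ i) = 0"
    using assms(2) by simp
  then show "Poly_Mapping.lookup (g i) m = Poly_Mapping.lookup 0 m"
    using indep[of "\<lambda>i. Poly_Mapping.lookup (g i) m" i] assms(3) mpoly_over_lookup[OF sring_K assms(1)] by simp
qed

lemma mpoly_expand:
  assumes "w \<in> mpoly_over L V"
  obtains g where "\<And>i. i < n \<Longrightarrow> g i \<in> mpoly_over K V" "w = (\<Sum>i<n. mconst (\<alpha> ^ i) * g i)"
proof -
  have "\<forall>m. \<exists>k. Poly_Mapping.lookup w m = (\<Sum>i<n. k i * \<alpha> ^ i) \<and> (\<forall>i<n. k i \<in> K)"
    using mpoly_over_lookup[OF sring_L assms] unfolding L_eq by auto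
  then obtain k where k: "\<And>m. Poly_Mapping.lookup w m = (\<Sum>i<n. k m i * \<alpha> ^ i)"
    "\<And>m i. i < n \<Longrightarrow> k m i \<in> K" by metis
  define g where "g i = (\<Sum>m\<in>Poly_Mapping.keys w. Poly_Mapping.single m (k m i))" for i
  show ?thesis
  proof (rule that)
    show "g i \<in> mpoly_over K V" if "i < n" for i
      unfolding g_def using assms k(2)[OF that]
      by (intro mpoly_over_sum sring_K mpoly_over_single) (auto simp: mpoly_over_def)
    show "w = (\<Sum>i<n. mconst (\<alpha> ^ i) * g i)"
    proof (rule poly_mapping_eqI)
      fix m
      have "Poly_Mapping.lookup (g i) m = (if m \<in> Poly_Mapping.keys w then k m i else 0)" for i
        by (auto simp: g_def lookup_sum lookup_single when_def)
      then have "Poly_Mapping.lookup (\<Sum>i<n. mconst (\<alpha> ^ i) * g i) m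
          = (\<Sum>i<n. \<alpha> ^ i * (if m \<in> Poly_Mapping.keys w then k m i else 0))"
        by (simp only: lookup_sum lookup_mconst_mult)
      also have "\<dots> = Poly_Mapping.lookup w m"
      proof (cases "m \<in> Poly_Mapping.keys w")
        case True
        then show ?thesis by (simp add: k(1) mult.commute)
      next
        case False
        then show ?thesis by (simp add: in_keys_iff)
      qed
      finally show "Poly_Mapping.lookup w m = Poly_Mapping.lookup (\<Sum>i<n. mconst (\<alpha> ^ i) * g i) m" ..
    qed
  qed
qed

text \<open>Stands in for a Galois action: the coefficient of each monomial in
  \<open>H(\<alpha>)\<close> is the value at \<alpha> of a polynomial over \<open>K\<close>, so it
  vanishes at \<beta> if it vanishes at \<alpha>.\<close>

lemma conjugate_transfer:
  assumes H: "H \<in> poly_over (mpoly_over K V)" and 0: "poly H (mconst \<alpha>) = 0" and \<beta>: "\<beta> \<in> conjugates"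
  shows "poly H (mconst \<beta>) = 0"
proof (rule poly_mapping_eqI)
  fix m
  define p where "p = map_poly (\<lambda>g. Poly_Mapping.lookup g m) H"
  have coeff_p: "poly.coeff p k = Poly_Mapping.lookup (poly.coeff H k) m" for k
    by (simp add: p_def coeff_map_poly)
  have "Polynomial.degree p \<le> Polynomial.degree H"
    by (rule degree_le) (auto simp: coeff_p coeff_eq_0)
  then have "poly p x = (\<Sum>k\<le>Polynomial.degree H. poly.coeff p k * x ^ k)" for x
    unfolding poly_altdef by (intro sum.mono_neutral_left) (auto simp: coeff_eq_0)
  moreover have "Poly_Mapping.lookup (g * mconst x ^ k) m = Poly_Mapping.lookup g m * x ^ k" for g :: "'f mpoly" and x k
    unfolding mconst_power[symmetric] mult.commute[of g] lookup_mconst_mult by simp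
  ultimately have lk: "Poly_Mapping.lookup (poly H (mconst x)) m = poly p x" for x
    unfolding poly_altdef[of H] lookup_sum by (simp add: coeff_p)
  have "p \<in> poly_over K"
    using H mpoly_over_lookup[OF sring_K] by (auto simp: poly_over_def coeff_p)
  moreover have "poly p \<alpha> = 0" using lk[of \<alpha>] 0 by simp
  ultimately show "Poly_Mapping.lookup (poly H (mconst \<beta>)) m = Poly_Mapping.lookup 0 m"
    using \<beta> lk[of \<beta>] by (simp add: conjugates_def)
qed

lemma K_subset_L: "K \<subseteq> L"
proof
  fix x assume "x \<in> K"
  then have "x = (\<Sum>i<n. (if i = 0 then x else 0) * \<alpha> ^ i)" "\<forall>i<n. (if i = 0 then x else 0) \<in> K"
    using n_pos sringD(1)[OF sring_K] by (auto simp: if_distrib[of "\<lambda>z. z * _"] cong: if_cong)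
  then show "x \<in> L"
    unfolding L_eq by (intro CollectI exI[of _ "\<lambda>i. if i = 0 then x else 0"]) blast
qed

lemma poly_L: "p \<in> poly_over K \<Longrightarrow> poly p \<alpha> \<in> L"
  unfolding poly_altdef using K_subset_L
  by (intro sring_sum sring_L sringD(4)[OF sring_L] sring_power alpha_L) (auto simp: poly_over_def)

text \<open>The inverse of \<open>p(\<alpha>)\<close> has the form \<open>g(\<alpha>)\<close> with
  \<open>g\<close> over \<open>K\<close>, and the relation \<open>p g = 1\<close> carries over to
  \<beta>.\<close>

lemma conjugate_nonzero:
  assumes p: "p \<in> poly_over K" "poly p \<alpha> \<noteq> 0" and \<beta>: "\<beta> \<in> conjugates"
  shows "poly p \<beta> \<noteq> 0"
proof -
  obtain g where g: "g \<in> poly_over K" "poly g \<alpha> = inverse (poly p \<alpha>)"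
    using L_imp_poly[OF inverse_L] poly_L p(1) by metis
  have "p * g - 1 \<in> poly_over K"
    by (intro poly_over_diff poly_over_mult poly_over_1 sring_K p g)
  moreover have "poly (p * g - 1) \<alpha> = 0" using p(2) g(2) by simp
  ultimately have "poly (p * g - 1) \<beta> = 0" using \<beta> by (auto simp: conjugates_def)
  then show ?thesis by auto
qed

text \<open>
  The product of the conjugate forms is the determinant of multiplication by one of them, written in
  the basis \<open>1, \<alpha>, \<dots>, \<alpha>\<^bsup>n-1\<^esup>\<close>; a Vandermonde matrix diagonalises it.
\<close>

lemma norm_form_over:
  assumes A: "A \<in> poly_over K" and C: "C \<in> poly_over K"
    and B: "B \<subseteq> conjugates" "finite B" "card B = n"
  shows "(\<Prod>\<beta>\<in>B. linear_form n (poly A \<beta>) (poly C \<beta>) \<beta>) \<in> mpoly_over K {..<n}"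
proof -
  let ?V = "{..<n} :: nat set"
  let ?lf = "\<lambda>\<beta>. linear_form n (poly A \<beta>) (poly C \<beta>) \<beta>"
  note sK = sring_mpoly_over[OF sring_K, of ?V]
  define F where "F = map_poly mconst A - map_poly mconst C * generic_poly n"
  have F: "poly F (mconst \<beta>) = ?lf \<beta>" for \<beta>
    by (simp add: F_def linear_form_def poly_map_poly_mconst poly_generic_poly)
  have F_over: "F \<in> poly_over (mpoly_over K ?V)"
    unfolding F_def
    by (intro poly_over_diff poly_over_mult sK map_poly_mconst_over sring_K A C generic_poly_over order.refl)
  \<comment> \<open>These coefficients form column \<open>j\<close> of the matrix of multiplication
    by the form.\<close>
  have "\<exists>g. (\<forall>i<n. g i \<in> mpoly_over K ?V) \<and> mconst (\<alpha> ^ j) * ?lf \<alpha> = (\<Sum>i<n. mconst (\<alpha> ^ i) * g i)" for j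
  proof -
    have "mconst (\<alpha> ^ j) * ?lf \<alpha> \<in> mpoly_over L ?V"
      unfolding linear_form_def
      by (intro mpoly_over_closed sring_L generic_elt_over sring_power alpha_L order.refl poly_L A C)
    then show ?thesis by (rule mpoly_expand) blast
  qed
  then have "\<exists>M. \<forall>j. (\<forall>i<n. M j i \<in> mpoly_over K ?V)
      \<and> mconst (\<alpha> ^ j) * ?lf \<alpha> = (\<Sum>i<n. mconst (\<alpha> ^ i) * M j i)"
    by (intro choice allI)
  then obtain M where M: "\<And>i j. i < n \<Longrightarrow> M j i \<in> mpoly_over K ?V"
    "\<And>j. mconst (\<alpha> ^ j) * ?lf \<alpha> = (\<Sum>i<n. mconst (\<alpha> ^ i) * M j i)" by blast
  \<comment> \<open>The same matrix describes multiplication by every conjugate form, since its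
    entries are over \<open>K\<close>.\<close>
  have M_conj: "mconst (\<beta> ^ j) * ?lf \<beta> = (\<Sum>i<n. mconst (\<beta> ^ i) * M j i)" if \<beta>: "\<beta> \<in> conjugates" for \<beta> j
  proof -
    define H where "H = Polynomial.monom 1 j * F - (\<Sum>i<n. Polynomial.monom (M j i) i)"
    have ev: "poly H (mconst x) = mconst (x ^ j) * ?lf x - (\<Sum>i<n. mconst (x ^ i) * M j i)" for x
      by (simp add: H_def poly_monom poly_sum F mconst_power mult.commute[of "M _ _"])
    have "H \<in> poly_over (mpoly_over K ?V)"
      unfolding H_def using M(1)
      by (intro poly_over_diff poly_over_mult poly_over_sum poly_over_monom sK F_over mpoly_over_1 sring_K) auto
    moreover have "poly H (mconst \<alpha>) = 0" using ev M(2) by simp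
    ultimately have "poly H (mconst \<beta>) = 0" using \<beta> by (rule conjugate_transfer)
    then show ?thesis using ev by simp
  qed
  obtain bs where bs: "set bs = B" "distinct bs" using finite_distinct_list[OF B(2)] by blast
  then have len: "length bs = n" using B(3) distinct_card by force
  have bs_conj: "bs ! k \<in> conjugates" if "k < n" for k using that len bs B(1) by force
  define Mm where "Mm = mat n n (\<lambda>(i, j). M j i)"
  define Vm where "Vm = mat n n (\<lambda>(k, i). mconst (bs ! k ^ i))"
  define Dm where "Dm = mat n n (\<lambda>(k, j). if k = j then ?lf (bs ! k) else 0)"
  have car: "Mm \<in> carrier_mat n n" "Vm \<in> carrier_mat n n" "Dm \<in> carrier_mat n n"
    by (simp_all add: Mm_def Vm_def Dm_def)
  \<comment> \<open>Row \<open>k\<close> of the Vandermonde matrix is a left eigenvector of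
    \<open>Mm\<close>, with the conjugate form at \<open>bs ! k\<close> as eigenvalue.\<close>
  have "Vm * Mm = Dm * Vm"
  proof (rule eq_matI)
    fix k j assume "k < dim_row (Dm * Vm)" "j < dim_col (Dm * Vm)"
    then have kj: "k < n" "j < n" using car by auto
    have "(Vm * Mm) $$ (k, j) = (\<Sum>i<n. mconst (bs ! k ^ i) * M j i)"
      using kj by (simp add: Vm_def Mm_def scalar_prod_def atLeast0LessThan)
    also have "\<dots> = ?lf (bs ! k) * mconst (bs ! k ^ j)"
      using M_conj[OF bs_conj[OF kj(1)]] by (simp add: mult.commute)
    also have "\<dots> = (Dm * Vm) $$ (k, j)"
      using kj by (simp add: Vm_def Dm_def scalar_prod_def atLeast0LessThan if_distrib[of "\<lambda>z. z * _"] cong: if_cong)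
    finally show "(Vm * Mm) $$ (k, j) = (Dm * Vm) $$ (k, j)" .
  qed (use car in auto)
  then have "det Vm * det Mm = det Dm * det Vm"
    unfolding det_mult[OF car(2,1), symmetric] det_mult[OF car(3,2), symmetric] by (rule arg_cong)
  \<comment> \<open>A kernel vector would be the coefficient list of a nonzero polynomial of degree
    below \<open>n\<close> with the \<open>n\<close> distinct elements of \<open>B\<close> as
    roots.\<close>
  moreover have "det Vm \<noteq> 0"
  proof
    assume "det Vm = 0"
    then obtain v where v: "v \<in> carrier_vec n" "v \<noteq> 0\<^sub>v n" "Vm *\<^sub>v v = 0\<^sub>v n"
      using det_0_iff_vec_prod_zero[OF car(2)] by blast
    define q where "q = (\<Sum>i<n. Polynomial.monom (v $ i) i)"
    have coeff_q: "poly.coeff q i = (if i < n then v $ i else 0)" for i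
      by (simp add: q_def coeff_sum)
    have "q \<noteq> 0"
    proof
      assume "q = 0"
      then have "v $ i = 0" if "i < n" for i using coeff_q[of i] that by simp
      then show False using v(1,2) by (auto intro!: eq_vecI)
    qed
    have "Polynomial.degree q < n"
      using \<open>q \<noteq> 0\<close> coeff_q by (metis leading_coeff_0_iff)
    moreover have "mconst ` B \<subseteq> {x. poly q x = 0}"
    proof
      fix x assume "x \<in> mconst ` B"
      then obtain k where k: "k < n" "x = mconst (bs ! k)"
        using bs len by (metis (no_types, lifting) imageE in_set_conv_nth)
      have "poly q x = (Vm *\<^sub>v v) $ k"
        using k v(1) by (simp add: q_def poly_sum poly_monom Vm_def scalar_prod_def atLeast0LessThan mconst_power mult.commute)
      then show "x \<in> {x. poly q x = 0}" using v(3) k by simp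
    qed
    then have "n \<le> card {x. poly q x = 0}"
      using card_mono[OF poly_roots_finite[OF \<open>q \<noteq> 0\<close>], of "mconst ` B"] B(3)
      by (simp add: card_image inj_on_def)
    ultimately show False using card_poly_roots_bound[OF \<open>q \<noteq> 0\<close>] by linarith
  qed
  ultimately have "det Mm = det Dm" by (simp add: mult.commute)
  also have "det Dm = prod_list (diag_mat Dm)"
    by (rule det_upper_triangular[OF _ car(3)]) (auto simp: Dm_def)
  also have "diag_mat Dm = map ?lf bs"
    unfolding diag_mat_def using len car by (auto simp: Dm_def intro!: nth_equalityI)
  also have "prod_list (map ?lf bs) = (\<Prod>\<beta>\<in>B. ?lf \<beta>)"
    unfolding bs(1)[symmetric] by (rule prod.distinct_set_conv_list[OF bs(2), symmetric])
  finally have "(\<Prod>\<beta>\<in>B. ?lf \<beta>) = det Mm" ..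
  also have "det Mm \<in> mpoly_over K ?V"
  proof -
    have "signof p \<in> mpoly_over K ?V" for p :: "nat \<Rightarrow> nat"
      by (auto simp: sign_def intro: mpoly_over_closed[OF sring_K])
    then show ?thesis
      unfolding det_def'[OF car(1)] using M(1)
      by (intro mpoly_over_sum mpoly_over_mult mpoly_over_prod sring_K) (auto simp: Mm_def permutes_def)
  qed
  finally show ?thesis .
qed

text \<open>For \<open>c \<noteq> 0\<close> the norm \<open>N\<close> of \<open>a - c X\<close>
  divides \<open>s\<close>, say \<open>s = N h\<close>. Cancelling the factor \<open>a - c X\<close>
  of \<open>N\<close> in the hypothesis shows that \<open>h\<close> divides
  \<open>\<Sum>\<^sub>i \<alpha>\<^sup>i r\<^sub>i\<close>, and therefore each
  \<open>r\<^sub>i\<close>. For \<open>c = 0\<close> the form is a constant, and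
  \<open>h = s\<close> with the empty product does the same.\<close>

lemma common_divisor:
  assumes P: "A \<in> poly_over K" "B \<in> poly_over K" "C \<in> poly_over K" "D \<in> poly_over K"
  defines "a \<equiv> poly A \<alpha>" and "b \<equiv> poly B \<alpha>" and "c \<equiv> poly C \<alpha>" and "d \<equiv> poly D \<alpha>"
  assumes \<Delta>: "a * d - b * c \<noteq> 0"
    and r: "\<And>i. i < n \<Longrightarrow> r i \<in> mpoly_over K {..<n}" and s: "s \<in> mpoly_over K {..<n}" "s \<noteq> 0"
    and eq: "linear_form n a c \<alpha> * (\<Sum>i<n. mconst (\<alpha> ^ i) * r i) = s * (mconst d * generic_elt n \<alpha> - mconst b)"
  obtains h S where "h \<in> mpoly_over K {..<n}" "h dvd s" "\<And>i. i < n \<Longrightarrow> h dvd r i"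
    "S \<subseteq> conjugates" "finite S" "s = (\<Prod>\<beta>\<in>S. linear_form n (poly A \<beta>) (poly C \<beta>) \<beta>) * h"
proof -
  let ?V = "{..<n} :: nat set"
  let ?lf = "\<lambda>\<beta>. linear_form n (poly A \<beta>) (poly C \<beta>) \<beta>"
  define R where "R = (\<Sum>i<n. mconst (\<alpha> ^ i) * r i)"
  have r_L: "r i \<in> mpoly_over L ?V" if "i < n" for i
    using mpoly_over_mono[OF K_subset_L order.refl r[OF that]] .
  have R_L: "R \<in> mpoly_over L ?V"
    unfolding R_def using r_L by (intro mpoly_over_closed sring_L sring_power alpha_L) auto
  \<comment> \<open>The cofactor \<open>w\<close> has coefficients in \<open>L\<close>; expanding it
    in powers of \<alpha> splits \<open>R = h w\<close> into one equation over \<open>K\<close> for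
    each \<open>r i\<close>.\<close>
  have dvd_r: "h dvd r i" if h: "h \<in> mpoly_over K ?V" "h \<noteq> 0" and w: "R = h * w" and i: "i < n" for h w i
  proof -
    have "w \<in> mpoly_over L ?V"
      using mpoly_over_quotient[OF sring_L inverse_L mpoly_over_mono[OF K_subset_L order.refl h(1)] R_L w h(2)] .
    then obtain g where g: "\<And>i. i < n \<Longrightarrow> g i \<in> mpoly_over K ?V" "w = (\<Sum>i<n. mconst (\<alpha> ^ i) * g i)"
      by (rule mpoly_expand) blast
    have "(\<Sum>i<n. mconst (\<alpha> ^ i) * (r i - h * g i)) = R - h * w"
      unfolding R_def g(2) by (simp add: sum_distrib_left sum_subtractf algebra_simps)
    then have "(\<Sum>i<n. mconst (\<alpha> ^ i) * (r i - h * g i)) = 0" using w by simp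
    then have "r i - h * g i = 0"
      by (rule mpoly_indep[where V = ?V, rotated])
         (auto intro!: mpoly_over_diff mpoly_over_mult sring_K r h g i)
    then show ?thesis by simp
  qed
  show ?thesis
  proof (cases "c = 0")
    case True
    then have "a \<noteq> 0" using \<Delta> by auto
    have "mconst a * R = s * (mconst d * generic_elt n \<alpha> - mconst b)"
      using eq True by (simp add: R_def linear_form_def)
    then have "mconst (inverse a) * (mconst a * R) = s * (mconst (inverse a) * (mconst d * generic_elt n \<alpha> - mconst b))"
      by (simp add: mult_ac)
    then have w: "R = s * (mconst (inverse a) * (mconst d * generic_elt n \<alpha> - mconst b))"
      using \<open>a \<noteq> 0\<close> by (simp add: mult.assoc[symmetric] mconst_mult[symmetric])
    show ?thesis
      by (rule that[of s "{}"]) (use s dvd_r[OF s w] in auto)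
  next
    case False
    obtain S where S: "S \<subseteq> conjugates" "\<alpha> \<in> S" "finite S" "card S = n" by (rule card_conjugates)
    note sK = sring_mpoly_over[OF sring_K, of ?V]
    have lf_dvd: "?lf \<beta> dvd s" if \<beta>: "\<beta> \<in> S" for \<beta>
    proof -
      define \<Delta>p where "\<Delta>p = A * D - B * C"
      \<comment> \<open>\<open>W\<close> takes the value \<open>c R + d s\<close> at \<alpha>, and
        \<open>(a - c X) (c R + d s) = (a d - b c) s\<close> shows that the form divides
        \<open>s\<close>. Stated through \<open>H\<close>, this identity has coefficients over
        \<open>K\<close> and carries over to every conjugate.\<close>
      define W where "W = map_poly mconst C * (\<Sum>i<n. Polynomial.monom (r i) i) + map_poly mconst D * [:s:]"
      define H where "H = [:s:] * map_poly mconst \<Delta>p - (map_poly mconst A - map_poly mconst C * generic_poly n) * W"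
      have ev: "poly H (mconst x) = s * mconst (poly \<Delta>p x) - ?lf x * poly W (mconst x)" for x
        by (simp add: H_def linear_form_def poly_map_poly_mconst poly_generic_poly)
      have \<Delta>p: "\<Delta>p \<in> poly_over K"
        unfolding \<Delta>p_def by (intro poly_over_diff poly_over_mult sring_K P)
      have "H \<in> poly_over (mpoly_over K ?V)"
        unfolding H_def W_def using r
        by (intro poly_over_diff poly_over_mult poly_over_add poly_over_sum poly_over_monom poly_over_const
            sK map_poly_mconst_over sring_K P \<Delta>p s generic_poly_over order.refl) auto
      moreover have "poly H (mconst \<alpha>) = 0"
      proof -
        have W: "poly W (mconst \<alpha>) = mconst c * R + mconst d * s"
          by (simp add: W_def R_def c_def d_def poly_sum poly_monom poly_map_poly_mconst mconst_power mult.commute)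
        have "?lf \<alpha> * (mconst c * R + mconst d * s) = mconst c * (?lf \<alpha> * R) + mconst d * s * ?lf \<alpha>"
          by (simp add: algebra_simps)
        also have "?lf \<alpha> * R = s * (mconst d * generic_elt n \<alpha> - mconst b)"
          using eq unfolding R_def a_def c_def .
        also have "mconst c * (s * (mconst d * generic_elt n \<alpha> - mconst b)) + mconst d * s * ?lf \<alpha>
            = s * (mconst a * mconst d - mconst b * mconst c)"
          unfolding linear_form_def a_def[symmetric] c_def[symmetric] by (simp add: algebra_simps)
        finally show ?thesis
          unfolding ev W by (simp add: \<Delta>p_def a_def b_def c_def d_def mconst_mult mconst_diff)
      qed
      ultimately have "poly H (mconst \<beta>) = 0"
        by (rule conjugate_transfer[OF _ _ subsetD[OF S(1) \<beta>]])
      then have "s * mconst (poly \<Delta>p \<beta>) = ?lf \<beta> * poly W (mconst \<beta>)" using ev by simp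
      then have "?lf \<beta> dvd s * mconst (poly \<Delta>p \<beta>) * mconst (inverse (poly \<Delta>p \<beta>))" by simp
      moreover have "poly \<Delta>p \<beta> \<noteq> 0"
        by (rule conjugate_nonzero[OF \<Delta>p]) (use S(1) \<beta> \<Delta> in \<open>auto simp: \<Delta>p_def a_def b_def c_def d_def\<close>)
      ultimately show ?thesis by (simp add: mult.assoc mconst_mult[symmetric])
    qed
    define N where "N = (\<Prod>\<beta>\<in>S. ?lf \<beta>)"
    have "N dvd s"
      unfolding N_def
      by (rule prod_linear_forms_dvd)
         (use S lf_dvd conjugate_nonzero[OF P(3)] False in \<open>auto simp: c_def\<close>)
    then obtain h where h: "s = N * h" by (elim dvdE)
    have N0: "N \<noteq> 0" "h \<noteq> 0" using h s(2) by auto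
    have N_K: "N \<in> mpoly_over K ?V"
      unfolding N_def by (rule norm_form_over[OF P(1,3) S(1,3,4)])
    then have h_K: "h \<in> mpoly_over K ?V"
      using mpoly_over_quotient[OF sring_K inverse_K N_K s(1) h N0(1)] by blast
    define N' where "N' = (\<Prod>\<beta>\<in>S - {\<alpha>}. ?lf \<beta>)"
    have NN: "N = ?lf \<alpha> * N'" unfolding N_def N'_def by (rule prod.remove[OF S(3,2)])
    have "?lf \<alpha> * R = ?lf \<alpha> * (h * (N' * (mconst d * generic_elt n \<alpha> - mconst b)))"
      using eq unfolding h NN R_def[symmetric] a_def c_def by (simp only: mult_ac)
    then have "R = h * (N' * (mconst d * generic_elt n \<alpha> - mconst b))"
      using N0(1) NN by simp
    with h_K N0(2) have "h dvd r i" if "i < n" for i using dvd_r that by blast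
    then show ?thesis
      by (intro that[of h S]) (use h h_K S N_def in auto)
  qed
qed

end

section \<open>Rational functions and parametrizations\<close>

lemma (in comm_ring_hom) map_poly_hom_mult: "map_poly hom (p * q) = map_poly hom p * map_poly hom q"
  by (rule poly_eqI) (simp add: coeff_map_poly coeff_mult hom_sum hom_mult)

text \<open>Cross-multiplication shows that every admissible fraction gives the same value, so the
  definite description denotes it.\<close>

lemma rat_subst_Fract:
  fixes h :: "'f::field \<Rightarrow> 'e::field"
  assumes h: "comm_ring_hom h" and q: "poly (map_poly h q) y \<noteq> 0"
  shows "rat_subst h (Fract p q) y = poly (map_poly h p) y / poly (map_poly h q) y"
  unfolding rat_subst_def
proof (rule the_equality)
  show "\<exists>p' q'. Fract p q = Fract p' q' \<and> poly (map_poly h q') y \<noteq> 0 \<and>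
      poly (map_poly h p) y / poly (map_poly h q) y = poly (map_poly h p') y / poly (map_poly h q') y"
    using q by blast
next
  interpret comm_ring_hom h by fact
  fix z
  assume "\<exists>p' q'. Fract p q = Fract p' q' \<and> poly (map_poly h q') y \<noteq> 0 \<and>
      z = poly (map_poly h p') y / poly (map_poly h q') y"
  then obtain p' q' where *: "Fract p q = Fract p' q'" "poly (map_poly h q') y \<noteq> 0"
    "z = poly (map_poly h p') y / poly (map_poly h q') y" by blast
  have "q \<noteq> 0" "q' \<noteq> 0" using q *(2) by auto
  then have "p * q' = p' * q" using *(1) by (simp add: eq_fract)
  then have "poly (map_poly h (p * q')) y = poly (map_poly h (p' * q)) y" by simp
  then show "z = poly (map_poly h p) y / poly (map_poly h q) y"
    unfolding *(3) using q *(2) by (simp add: map_poly_hom_mult frac_eq_eq)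
qed

lemma rat_const_hom: "comm_ring_hom rat_const"
  by unfold_locales (auto simp: rat_const_def Zero_fract_def One_fract_def one_pCons mult.commute)

lemma mrat_const_hom: "comm_ring_hom mrat_const"
  by unfold_locales (auto simp: mrat_const_def Zero_fract_def One_fract_def mconst_add mconst_mult)

lemma sum_Fract_1: "(\<Sum>i\<in>S. Fract (f i) 1) = Fract (\<Sum>i\<in>S. f i) (1::'a::idom)"
  by (induction S rule: infinite_finite_induct) (auto simp: Zero_fract_def)

lemma sum_Fract: "(q::'a::idom) \<noteq> 0 \<Longrightarrow> (\<Sum>i\<in>S. Fract (f i) q) = Fract (\<Sum>i\<in>S. f i) q"
  by (induction S rule: infinite_finite_induct) (auto simp: Zero_fract_def eq_fract algebra_simps)

text \<open>Solve \<open>u(v) = t\<close> for \<open>v\<close>. The definition of composition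
  supplies only some fraction \<open>p / q\<close> for \<open>u\<close>; cross-multiplying with the
  given one turns \<open>p(v) = t q(v)\<close> into \<open>a v + b = t (c v + d)\<close>, which is
  linear in \<open>v\<close>.\<close>

lemma comp_inverse_moebius:
  fixes a b c d :: "'f::field"
  assumes inv: "is_comp_inverse u v" and u: "u = Fract [:b, a:] [:d, c:]" and \<Delta>: "a * d - b * c \<noteq> 0"
  shows "v = Fract [:- b, d:] [:a, - c:]"
proof -
  interpret comm_ring_hom "rat_const :: 'f \<Rightarrow> 'f poly fract" by (rule rat_const_hom)
  from inv obtain p q where pq: "u = Fract p q" "poly (map_poly rat_const q) v \<noteq> 0"
    unfolding is_comp_inverse_def rat_defined_def by blast
  have t: "poly (map_poly rat_const p) v = rat_t * poly (map_poly rat_const q) v"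
    using inv rat_subst_Fract[OF rat_const_hom pq(2), of p] pq
    by (simp add: is_comp_inverse_def rat_comp_def field_simps)
  have "q \<noteq> 0" using pq(2) by auto
  moreover have "[:d, c:] \<noteq> 0" using \<Delta> by auto
  ultimately have "p * [:d, c:] = [:b, a:] * q"
    using pq(1) u by (simp add: eq_fract mult.commute)
  then have "poly (map_poly rat_const (p * [:d, c:])) v = poly (map_poly rat_const ([:b, a:] * q)) v"
    by simp
  then have "(rat_t * (rat_const d + v * rat_const c) - (rat_const b + v * rat_const a)) * poly (map_poly rat_const q) v = 0"
    by (simp only: map_poly_hom_mult poly_mult t) (simp add: map_poly_pCons algebra_simps)
  then have "rat_t * (rat_const d + v * rat_const c) - (rat_const b + v * rat_const a) = 0"
    using pq(2) by (simp only: mult_eq_0_iff simp_thms)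
  then have "v * (rat_const a - rat_t * rat_const c) = rat_t * rat_const d - rat_const b"
    by (simp add: algebra_simps)
  moreover have "rat_const a - rat_t * rat_const c = Fract [:a, - c:] 1"
    by (simp add: rat_const_def rat_t_def)
  moreover have "rat_t * rat_const d - rat_const b = Fract [:- b, d:] 1"
    by (simp add: rat_const_def rat_t_def)
  moreover have "[:a, - c:] \<noteq> 0" using \<Delta> by auto
  ultimately have "v * (Fract [:a, - c:] 1) = Fract [:- b, d:] 1" "Fract [:a, - c:] 1 \<noteq> 0"
    by (simp_all add: Zero_fract_def eq_fract)
  then have "v = Fract [:- b, d:] 1 / Fract [:a, - c:] 1"
    by (metis nonzero_mult_div_cancel_right)
  then show ?thesis by simp
qed

lemma linear_form_nonzero:
  assumes "0 < n" "a \<noteq> 0 \<or> c \<noteq> 0"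
  shows "linear_form n a c \<beta> \<noteq> 0"
proof (cases "c = 0")
  case True
  then show ?thesis using assms by (simp add: linear_form_def)
next
  case False
  then have "Poly_Mapping.lookup (linear_form n a c \<beta>) (Poly_Mapping.single 0 (Suc 0)) \<noteq> 0"
    using lookup_linear_form[OF assms(1), of a c \<beta>] by simp
  then show ?thesis by auto
qed

text \<open>The form \<open>a - c X\<close> is nonzero, so both sides of the expansion are fractions
  of polynomials and cross-multiplication gives an identity of polynomials.\<close>

lemma moebius_expansion:
  fixes a b c d :: "'f::field"
  assumes n: "0 < n" and \<Delta>: "a * d - b * c \<noteq> 0" and "s \<noteq> 0"
    and eq: "rat_subst mrat_const (Fract [:- b, d:] [:a, - c:]) (\<Sum>i<n. mrat_const (\<alpha> ^ i) * Fract (mvar i) 1) =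
      (\<Sum>i<n. Fract (r i) s * mrat_const (\<alpha> ^ i))"
  shows "linear_form n a c \<alpha> * (\<Sum>i<n. mconst (\<alpha> ^ i) * r i) = s * (mconst d * generic_elt n \<alpha> - mconst b)"
proof -
  interpret comm_ring_hom "mrat_const :: 'f \<Rightarrow> 'f mpoly fract" by (rule mrat_const_hom)
  have X: "(\<Sum>i<n. mrat_const (\<alpha> ^ i) * Fract (mvar i) 1) = Fract (generic_elt n \<alpha>) 1"
    by (simp add: mrat_const_def sum_Fract_1 generic_elt_def)
  have den: "poly (map_poly mrat_const [:a, - c:]) (Fract (generic_elt n \<alpha>) 1) = Fract (linear_form n a c \<alpha>) 1"
    by (simp add: map_poly_pCons hom_uminus) (simp add: mrat_const_def linear_form_def mult.commute)
  have num: "poly (map_poly mrat_const [:- b, d:]) (Fract (generic_elt n \<alpha>) 1)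
      = Fract (mconst d * generic_elt n \<alpha> - mconst b) 1"
    by (simp add: map_poly_pCons hom_uminus) (simp add: mrat_const_def mult.commute)
  have lf: "linear_form n a c \<alpha> \<noteq> 0"
    using \<Delta> by (intro linear_form_nonzero n) auto
  have "(\<Sum>i<n. Fract (r i) s * mrat_const (\<alpha> ^ i)) = Fract (\<Sum>i<n. mconst (\<alpha> ^ i) * r i) s"
    using \<open>s \<noteq> 0\<close> by (simp add: mrat_const_def sum_Fract mult.commute)
  moreover have "rat_subst mrat_const (Fract [:- b, d:] [:a, - c:]) (Fract (generic_elt n \<alpha>) 1)
      = Fract (mconst d * generic_elt n \<alpha> - mconst b) 1 / Fract (linear_form n a c \<alpha>) 1"
    using lf by (subst rat_subst_Fract[OF mrat_const_hom]) (simp_all only: den num, simp add: Zero_fract_def eq_fract)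
  ultimately have "Fract (mconst d * generic_elt n \<alpha> - mconst b) (linear_form n a c \<alpha>) = Fract (\<Sum>i<n. mconst (\<alpha> ^ i) * r i) s"
    using eq unfolding X by simp
  then show ?thesis using lf \<open>s \<noteq> 0\<close> by (simp add: eq_fract mult_ac)
qed

text \<open>Take a common denominator \<open>q\<close> of least degree. A nonzero element of least
  degree in the ideal of \<open>q\<close> and all \<open>p i\<close> over \<open>K\<close> divides
  them all; minimality of \<open>q\<close> makes it a constant, and this is the Bezout
  identity.\<close>

lemma common_denominator:
  fixes K :: "'f::field set" and n :: nat
  assumes K: "sring K" and inv: "\<And>x. x \<in> K \<Longrightarrow> inverse x \<in> K"
    and \<phi>: "\<And>i. i < n \<Longrightarrow> \<phi> i \<in> rat_over K"
  obtains p q where "q \<in> poly_over K" "q \<noteq> 0" "\<And>i. i < n \<Longrightarrow> p i \<in> poly_over K"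
    "\<And>i. i < n \<Longrightarrow> \<phi> i = Fract (p i) q" "\<exists>e f. e * q + (\<Sum>i<n. f i * p i) = 1"
proof -
  let ?P = "\<lambda>(q, p). q \<in> poly_over K \<and> q \<noteq> 0 \<and> (\<forall>i<n. p i \<in> poly_over K \<and> \<phi> i = Fract (p i) q)"
  have "\<forall>i. \<exists>a b. i < n \<longrightarrow> \<phi> i = Fract a b \<and> a \<in> poly_over K \<and> b \<in> poly_over K \<and> b \<noteq> 0"
    using \<phi> unfolding rat_over_def poly_over_iff_coeffs[OF K] by blast
  then obtain P Q where PQ: "\<And>i. i < n \<Longrightarrow> \<phi> i = Fract (P i) (Q i)" "\<And>i. i < n \<Longrightarrow> P i \<in> poly_over K"
    "\<And>i. i < n \<Longrightarrow> Q i \<in> poly_over K" "\<And>i. i < n \<Longrightarrow> Q i \<noteq> 0" by metis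
  \<comment> \<open>The product of the denominators shows that some common denominator
    exists.\<close>
  have "?P (\<Prod>i<n. Q i, \<lambda>i. P i * (\<Prod>j\<in>{..<n} - {i}. Q j))"
  proof (intro case_prodI conjI allI impI)
    show nz: "(\<Prod>i<n. Q i) \<noteq> 0" using PQ(4) by simp
    fix i assume i: "i < n"
    then have "(\<Prod>i<n. Q i) = Q i * (\<Prod>j\<in>{..<n} - {i}. Q j)" by (intro prod.remove) auto
    then show "\<phi> i = Fract (P i * (\<Prod>j\<in>{..<n} - {i}. Q j)) (\<Prod>i<n. Q i)"
      using PQ(1,4)[OF i] nz by (simp add: eq_fract mult_ac)
  qed (use PQ in \<open>auto intro!: poly_over_prod poly_over_mult K\<close>)
  from ex_has_least_nat[of ?P, OF this, of "\<lambda>qp. Polynomial.degree (fst qp)"]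
  obtain qp where "?P qp" and min: "\<And>qp'. ?P qp' \<Longrightarrow> Polynomial.degree (fst qp) \<le> Polynomial.degree (fst qp')"
    by (elim exE conjE) (rule that, assumption, elim allE impE)
  obtain q p where "qp = (q, p)" by force
  with \<open>?P qp\<close> have q: "q \<in> poly_over K" "q \<noteq> 0" and p: "\<And>i. i < n \<Longrightarrow> p i \<in> poly_over K"
    and \<phi>_eq: "\<And>i. i < n \<Longrightarrow> \<phi> i = Fract (p i) q"
    by auto
  have min': "Polynomial.degree q \<le> Polynomial.degree q'" if "?P (q', p')" for q' p'
    using min[OF that] \<open>qp = (q, p)\<close> by simp
  define J where "J = {e * q + (\<Sum>i<n. f i * p i) | e f. e \<in> poly_over K \<and> (\<forall>i<n. f i \<in> poly_over K)}"
  have J_K: "x \<in> poly_over K" if "x \<in> J" for x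
    using that q p unfolding J_def by (auto intro!: poly_over_add poly_over_mult poly_over_sum K)
  have q_J: "q \<in> J"
    unfolding J_def
    by (intro CollectI exI[of _ 1] exI[of _ "\<lambda>_. 0"]) (auto intro: poly_over_0 poly_over_1 K)
  have p_J: "p j \<in> J" if "j < n" for j
    unfolding J_def using that
    by (intro CollectI exI[of _ 0] exI[of _ "\<lambda>i. if i = j then 1 else 0"])
       (auto intro: poly_over_0 poly_over_1 K simp: if_distrib[of "\<lambda>z. z * _"] cong: if_cong)
  have diff_J: "x - k * y \<in> J" if xy: "x \<in> J" "y \<in> J" "k \<in> poly_over K" for x y k
  proof -
    obtain e f where x: "x = e * q + (\<Sum>i<n. f i * p i)" "e \<in> poly_over K" "\<forall>i<n. f i \<in> poly_over K"
      using xy(1) unfolding J_def by blast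
    obtain e' f' where y: "y = e' * q + (\<Sum>i<n. f' i * p i)" "e' \<in> poly_over K" "\<forall>i<n. f' i \<in> poly_over K"
      using xy(2) unfolding J_def by blast
    show ?thesis
      unfolding J_def
    proof (intro CollectI exI conjI)
      show "x - k * y = (e - k * e') * q + (\<Sum>i<n. (f i - k * f' i) * p i)"
        unfolding x(1) y(1) by (simp add: algebra_simps sum_distrib_left sum_subtractf)
    qed (use x y xy in \<open>auto intro!: poly_over_diff poly_over_mult K\<close>)
  qed
  obtain g where g: "g \<in> J \<and> g \<noteq> 0" and g_min: "\<And>x. x \<in> J \<and> x \<noteq> 0 \<Longrightarrow> Polynomial.degree g \<le> Polynomial.degree x"
    using ex_has_least_nat[of "\<lambda>x. x \<in> J \<and> x \<noteq> 0" q Polynomial.degree] q_J q(2) by blast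
  have quot: "\<exists>k\<in>poly_over K. x = k * g" if xJ: "x \<in> J" for x
  proof -
    obtain k r where kr: "k \<in> poly_over K" "r \<in> poly_over K" "x = k * g + r"
      "r = 0 \<or> Polynomial.degree r < Polynomial.degree g"
      using poly_over_division[OF K inv J_K[of g] _ J_K[OF xJ]] g by blast
    have "r \<in> J" using diff_J[OF xJ _ kr(1), of g] g kr(3) by simp
    then have "r = 0" using kr(4) g_min[of r] by (metis not_le)
    then show ?thesis using kr by auto
  qed
  obtain q' where q': "q' \<in> poly_over K" "q = q' * g" using quot[OF q_J] by blast
  have "\<forall>i. \<exists>k. i < n \<longrightarrow> k \<in> poly_over K \<and> p i = k * g" using quot p_J by blast
  then obtain p' where p': "\<And>i. i < n \<Longrightarrow> p' i \<in> poly_over K" "\<And>i. i < n \<Longrightarrow> p i = p' i * g" by metis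
  have "q' \<noteq> 0" using q' q by auto
  have "?P (q', p')"
    using q' p' g \<open>q' \<noteq> 0\<close> \<phi>_eq by (auto simp: eq_fract q(2))
  \<comment> \<open>Dividing everything by \<open>g\<close> gives another common denominator
    \<open>q'\<close>, so \<open>g\<close> cannot have positive degree.\<close>
  then have "Polynomial.degree q \<le> Polynomial.degree q'" by (rule min')
  then have "Polynomial.degree g = 0" using q' \<open>q' \<noteq> 0\<close> g by (simp add: degree_mult_eq)
  then obtain \<gamma> where \<gamma>: "g = [:\<gamma>:]" by (rule degree_eq_zeroE)
  with g have "\<gamma> \<noteq> 0" by auto
  obtain e f where ef: "g = e * q + (\<Sum>i<n. f i * p i)" using g unfolding J_def by blast
  have "([:inverse \<gamma>:] * e) * q + (\<Sum>i<n. ([:inverse \<gamma>:] * f i) * p i) = [:inverse \<gamma>:] * g"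
    unfolding ef distrib_left sum_distrib_left by (simp add: mult.assoc)
  also have "\<dots> = 1" using \<gamma> \<open>\<gamma> \<noteq> 0\<close> by (simp add: one_pCons)
  finally have "\<exists>e f. e * q + (\<Sum>i<n. f i * p i) = 1"
    by (intro exI[of _ "[:inverse \<gamma>:] * e"] exI[of _ "\<lambda>i. [:inverse \<gamma>:] * f i"])
  then show ?thesis by (intro that[of q p] q p \<phi>_eq)
qed

text \<open>If all coordinates are defined at a zero of \<open>q\<close>, then all
  \<open>p i\<close> vanish there, against the Bezout identity. So the admissible parameters are
  exactly the nonzeros of \<open>q\<close>.\<close>

lemma param_image_common_denominator:
  fixes \<phi> :: "nat \<Rightarrow> 'f::field poly fract"
  assumes \<phi>: "\<And>i. i < n \<Longrightarrow> \<phi> i = Fract (p i) q" and "q \<noteq> 0"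
    and bezout: "e * q + (\<Sum>i<n. f i * p i) = 1"
  shows "param_image n \<phi> = {\<lambda>i\<in>{..<n}. poly (p i) t / poly q t | t. poly q t \<noteq> 0}"
proof -
  have sub: "rat_subst id (\<phi> i) t = poly (p i) t / poly q t" if "i < n" "poly q t \<noteq> 0" for i t
    using rat_subst_Fract[OF id_comm_ring_hom, of q t "p i"] that \<phi> by (simp add: map_poly_id')
  have "(\<forall>i<n. rat_defined id (\<phi> i) t) \<longleftrightarrow> poly q t \<noteq> 0" for t
  proof
    assume "poly q t \<noteq> 0"
    then show "\<forall>i<n. rat_defined id (\<phi> i) t"
      unfolding rat_defined_def using \<phi> by (metis map_poly_id eq_id_iff)
  next
    assume def: "\<forall>i<n. rat_defined id (\<phi> i) t"
    show "poly q t \<noteq> 0"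
    proof
      assume q0: "poly q t = 0"
      have "poly (p i) t = 0" if i: "i < n" for i
      proof -
        obtain P Q where "\<phi> i = Fract P Q" and PQ': "poly (map_poly id Q) t \<noteq> 0"
          using def i unfolding rat_defined_def by blast
        then have PQ: "Fract (p i) q = Fract P Q" "poly (map_poly id Q) t \<noteq> 0"
          using \<phi>[OF i] by auto
        then have "poly Q t \<noteq> 0" by (simp add: map_poly_id')
        then have "Q \<noteq> 0" by auto
        then have "p i * Q = P * q" using PQ(1) \<open>q \<noteq> 0\<close> by (simp add: eq_fract)
        then have "poly (p i) t * poly Q t = poly P t * poly q t" by (metis poly_mult)
        then show ?thesis using q0 \<open>poly Q t \<noteq> 0\<close> by simp
      qed
      then have "poly (e * q + (\<Sum>i<n. f i * p i)) t = 0"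
        using q0 by (simp add: poly_sum)
      then show False unfolding bezout by simp
    qed
  qed
  then have "param_image n \<phi> = {\<lambda>i\<in>{..<n}. rat_subst id (\<phi> i) t | t. poly q t \<noteq> 0}"
    unfolding param_image_def by simp
  also have "\<dots> = {\<lambda>i\<in>{..<n}. poly (p i) t / poly q t | t. poly q t \<noteq> 0}"
  proof -
    have "(\<lambda>i\<in>{..<n}. rat_subst id (\<phi> i) t) = (\<lambda>i\<in>{..<n}. poly (p i) t / poly q t)" if "poly q t \<noteq> 0" for t
      using sub[OF _ that] by (auto simp: restrict_def)
    then show ?thesis by (metis (no_types, lifting))
  qed
  finally show ?thesis .
qed

lemma vanishing_ideal_zariski_closure:
  assumes "S \<subseteq> affine_space TYPE('f::field) n"
  shows "vanishing_ideal n (zariski_closure n S) = vanishing_ideal n S"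
  using assms unfolding vanishing_ideal_def zariski_closure_def by auto

section \<open>Clearing denominators\<close>

definition tdeg :: "(nat \<Rightarrow>\<^sub>0 nat) \<Rightarrow> nat" where
  "tdeg m = (\<Sum>i\<in>Poly_Mapping.keys m. Poly_Mapping.lookup m i)"

text \<open>\<open>q\<^sup>k P(x/q)\<close>, written without division; meaningful only if \<open>k\<close> bounds the degree of \<open>P\<close>.\<close>

definition clear_denom :: "('f::field \<Rightarrow> 'r::comm_ring_1) \<Rightarrow> nat \<Rightarrow> (nat \<Rightarrow> 'r) \<Rightarrow> 'r \<Rightarrow> 'f mpoly \<Rightarrow> 'r" where
  "clear_denom h k x q P =
     (\<Sum>m\<in>Poly_Mapping.keys P. h (Poly_Mapping.lookup P m) * monom_val x m * q ^ (k - tdeg m))"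

lemma monom_val_times: "monom_val (\<lambda>i. y i * q) m = monom_val y m * q ^ tdeg m"
  by (simp add: monom_val_def tdeg_def power_mult_distrib prod.distrib power_sum)

lemma monom_val_cong: "(\<And>i. i \<in> Poly_Mapping.keys m \<Longrightarrow> x i = y i) \<Longrightarrow> monom_val x m = monom_val y m"
  unfolding monom_val_def by (rule prod.cong) auto

lemma clear_denom_eq:
  assumes k: "\<And>m. m \<in> Poly_Mapping.keys P \<Longrightarrow> tdeg m \<le> k" and P: "P \<in> mpoly_over UNIV V"
    and x: "\<And>i. i \<in> V \<Longrightarrow> x i = y i * q"
  shows "clear_denom h k x q P = q ^ k * gev h y P"
proof -
  have "monom_val x m * q ^ (k - tdeg m) = q ^ k * monom_val y m" if "m \<in> Poly_Mapping.keys P" for m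
  proof -
    have "monom_val x m = monom_val y m * q ^ tdeg m"
      unfolding monom_val_times[symmetric] using that P x by (intro monom_val_cong) (auto simp: mpoly_over_def)
    moreover have "q ^ tdeg m * q ^ (k - tdeg m) = q ^ k"
      using k[OF that] by (simp add: power_add[symmetric])
    ultimately show ?thesis by (simp add: mult_ac)
  qed
  then show ?thesis
    unfolding clear_denom_def gev_def sum_distrib_left by (intro sum.cong) (auto simp: mult.assoc mult.left_commute)
qed

text \<open>Without division the expression commutes with all ring homomorphisms; it can thus be
  read at parameter values as well as at the polynomial parameter \<open>T\<close>.\<close>

lemma clear_denom_hom:
  assumes "comm_ring_hom g"
  shows "g (clear_denom h k x q P) = clear_denom (g \<circ> h) k (g \<circ> x) (g q) P"
proof -
  interpret g: comm_ring_hom g by fact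
  show ?thesis
    by (simp add: clear_denom_def g.hom_sum g.hom_mult g.hom_power monom_val_def g.hom_prod)
qed

lemma clear_denom_ideal:
  assumes I: "ideal_over W I" and W: "sring W" and P: "P \<in> mpoly_over UNIV V"
    and h: "\<And>c. h c \<in> W" and q: "q \<in> W"
    and xy: "\<And>i. i \<in> V \<Longrightarrow> x i \<in> W \<and> y i \<in> W \<and> x i - y i \<in> I"
  shows "clear_denom h k x q P - clear_denom h k y q P \<in> I"
proof -
  have "clear_denom h k x q P - clear_denom h k y q P
      = (\<Sum>m\<in>Poly_Mapping.keys P. (h (Poly_Mapping.lookup P m) * q ^ (k - tdeg m)) * (monom_val x m - monom_val y m))"
    by (simp add: clear_denom_def sum_subtractf algebra_simps)
  also have "\<dots> \<in> I"
    using P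
    by (intro ideal_over_sum[OF I] ideal_overD(3)[OF I] sringD(4)[OF W] h sring_power[OF W] q
          ideal_over_monom_val_diff[OF I W] xy) (auto simp: mpoly_over_def)
  finally show ?thesis .
qed

lemma finite_tdeg_bound:
  "finite A \<Longrightarrow> \<exists>k. \<forall>P\<in>A. \<forall>m\<in>Poly_Mapping.keys P. tdeg m \<le> k"
proof -
  assume "finite A"
  then have "finite (\<Union>P\<in>A. tdeg ` Poly_Mapping.keys P)" by auto
  then show ?thesis
    by (intro exI[of _ "Max (\<Union>P\<in>A. tdeg ` Poly_Mapping.keys P)"] ballI Max_ge) auto
qed

text \<open>The product \<open>p q\<close> vanishes everywhere, hence is zero because the field is
  infinite.\<close>

lemma poly_eq_0_off_roots:
  fixes p q :: "'f::field_char_0 poly"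
  assumes "q \<noteq> 0" "\<And>t. poly q t \<noteq> 0 \<Longrightarrow> poly p t = 0"
  shows "p = 0"
proof -
  have "poly (p * q) t = 0" for t using assms(2)[of t] by auto
  then have "p * q = 0" using poly_all_0_iff_0 by blast
  then show ?thesis using assms(1) by simp
qed

lemma poly_eval_hom: "comm_ring_hom (\<lambda>p. poly p (t::'a::comm_ring_1))"
  by unfold_locales auto

section \<open>Substitution into univariate polynomials, and evaluation at points\<close>

definition upoly :: "'f::field mpoly \<Rightarrow> 'f poly \<Rightarrow> 'f mpoly" where
  "upoly T p = poly (map_poly mconst p) T"

lemma upoly_hom: "comm_ring_hom (upoly T)"
proof -
  interpret comm_ring_hom mconst by (rule mconst_comm_ring_hom)
  have "map_poly mconst (p + q) = map_poly mconst p + map_poly mconst q" for p q :: "'a poly"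
    by (rule poly_eqI) (simp add: coeff_map_poly mconst_add)
  then show ?thesis
    by unfold_locales (auto simp: upoly_def map_poly_hom_mult)
qed

lemma upoly_pCons [simp]: "upoly T (pCons c p) = mconst c + T * upoly T p"
  by (simp add: upoly_def map_poly_pCons)

lemma upoly_0 [simp]: "upoly T 0 = 0"
  by (simp add: upoly_def)

lemma upoly_over:
  assumes K: "sring K" and p: "p \<in> poly_over K" and T: "T \<in> mpoly_over K V"
  shows "upoly T p \<in> mpoly_over K V"
proof -
  have "poly.coeff (map_poly mconst p) i \<in> mpoly_over K V" for i
    using p by (auto simp: coeff_map_poly poly_over_def intro: mpoly_over_mconst K)
  then show ?thesis
    unfolding upoly_def poly_altdef
    by (intro mpoly_over_sum mpoly_over_mult mpoly_over_power K T)
qed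

lemma meval_hom: "comm_ring_hom (meval x :: 'f::field mpoly \<Rightarrow> 'f)"
proof -
  have "meval x = gev id x" by (rule ext) (rule meval_eq_gev)
  then show ?thesis
    using coeff_hom.gev_comm_ring_hom[of id x] by (simp add: coeff_hom_def id_comm_ring_hom)
qed

lemma meval_mconst [simp]: "meval x (mconst c) = c"
  and meval_mvar [simp]: "meval x (mvar i) = x i"
proof -
  interpret coeff_hom "id :: 'a \<Rightarrow> 'a" by (simp add: coeff_hom_def id_comm_ring_hom)
  show "meval x (mconst c) = c" "meval x (mvar i) = x i"
    by (simp_all add: meval_eq_gev gev_mconst gev_mvar)
qed

lemma meval_simps [simp]:
  "meval x (p + q) = meval x p + meval x q" "meval x (p * q) = meval x p * meval x q"
  "meval x (p - q) = meval x p - meval x q" "meval x (- p) = - meval x p"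
  "meval x 0 = 0" "meval x 1 = 1" "meval x (p ^ k) = meval x p ^ k"
proof -
  interpret comm_ring_hom "meval x :: 'a mpoly \<Rightarrow> 'a" by (rule meval_hom)
  show "meval x (p + q) = meval x p + meval x q" "meval x (p * q) = meval x p * meval x q"
    "meval x (p - q) = meval x p - meval x q" "meval x (- p) = - meval x p"
    "meval x 0 = 0" "meval x 1 = 1" "meval x (p ^ k) = meval x p ^ k"
    by (simp_all add: hom_add hom_mult hom_minus hom_uminus hom_power)
qed

lemma meval_sum: "meval x (sum f A) = (\<Sum>i\<in>A. meval x (f i))"
  by (induction A rule: infinite_finite_induct) auto

lemma meval_prod: "meval x (prod f A) = (\<Prod>i\<in>A. meval x (f i))"
  by (induction A rule: infinite_finite_induct) auto

lemma meval_upoly: "meval x (upoly T p) = poly p (meval x T)"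
  by (induction p) auto

lemma meval_cong: "p \<in> mpoly_over K V \<Longrightarrow> (\<And>i. i \<in> V \<Longrightarrow> x i = y i) \<Longrightarrow> meval x p = meval y p"
  unfolding meval_eq_gev by (rule gev_cong)

section \<open>Generated ideals of the polynomial ring\<close>

lemma ring_mpoly_ring: "ring (mpoly_ring TYPE('f::field) V)"
proof -
  interpret ring "ring_of_type_algebra :: 'f mpoly ring" by (rule ring_from_type_algebra)
  note [simp] = type_ring_simps[where 'a = "'f mpoly"]
  show ?thesis
    unfolding mpoly_ring_def
    by (intro subring_is_ring subringI) (auto intro: mpoly_over_closed[OF sring_UNIV])
qed

lemma mpoly_ring_simps:
  "carrier (mpoly_ring TYPE('f::field) V) = mpoly_over UNIV V"
  "monoid.mult (mpoly_ring TYPE('f) V) = (*)" "add (mpoly_ring TYPE('f) V) = (+)"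
  "zero (mpoly_ring TYPE('f) V) = 0"
  by (auto simp: mpoly_ring_def ring_of_type_algebra_def)

lemma ideal_over_genideal:
  assumes "G \<subseteq> mpoly_over UNIV V"
  shows "ideal_over (mpoly_over UNIV V) (genideal (mpoly_ring TYPE('f::field) V) G)"
    and "G \<subseteq> genideal (mpoly_ring TYPE('f) V) G"
proof -
  interpret ring "mpoly_ring TYPE('f) V" by (rule ring_mpoly_ring)
  show "G \<subseteq> genideal (mpoly_ring TYPE('f) V) G"
    using genideal_self assms by (simp add: mpoly_ring_simps)
  interpret I: ideal "genideal (mpoly_ring TYPE('f) V) G" "mpoly_ring TYPE('f) V"
    using genideal_ideal assms by (simp add: mpoly_ring_simps)
  show "ideal_over (mpoly_over UNIV V) (genideal (mpoly_ring TYPE('f) V) G)"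
    unfolding ideal_over_def
    using I.zero_closed I.a_closed I.I_l_closed by (simp add: mpoly_ring_simps)
qed

lemma genideal_subset:
  assumes I: "ideal_over (mpoly_over UNIV V) I" and "I \<subseteq> mpoly_over UNIV V" "G \<subseteq> I"
  shows "genideal (mpoly_ring TYPE('f::field) V) G \<subseteq> I"
proof -
  interpret ring "mpoly_ring TYPE('f) V" by (rule ring_mpoly_ring)
  note [simp] = mpoly_ring_simps[where 'f = 'f]
  have uminus: "\<ominus>\<^bsub>mpoly_ring TYPE('f) V\<^esub> x \<in> I" if "x \<in> I" for x
  proof -
    have "x \<in> mpoly_over UNIV V" using that assms(2) by auto
    then have "\<ominus>\<^bsub>mpoly_ring TYPE('f) V\<^esub> x = - x"
      using minus_equality[of "- x" x] by (simp add: mpoly_over_uminus sring_UNIV)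
    moreover have "0 - x \<in> I"
      by (rule ideal_over_diff[OF I sring_mpoly_over[OF sring_UNIV] ideal_overD(1)[OF I] that])
    ultimately show ?thesis by simp
  qed
  have "ideal I (mpoly_ring TYPE('f) V)"
  proof (rule idealI[OF ring_mpoly_ring])
    show "subgroup I (add_monoid (mpoly_ring TYPE('f) V))"
      using assms(2) ideal_overD(1,2)[OF I] uminus by (intro add.subgroupI) auto
    fix a x assume "a \<in> I" "x \<in> carrier (mpoly_ring TYPE('f) V)"
    then have "x * a \<in> I" using ideal_overD(3)[OF I] by simp
    then show "x \<otimes>\<^bsub>mpoly_ring TYPE('f) V\<^esub> a \<in> I" "a \<otimes>\<^bsub>mpoly_ring TYPE('f) V\<^esub> x \<in> I"
      by (simp_all add: mult.commute[of x a])
  qed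
  then show ?thesis using genideal_minimal assms(3) by blast
qed

section \<open>The elimination ideal\<close>

text \<open>The situation in terms of polynomials alone: \<open>param\<close> says
  \<open>u = \<Sum>\<^sub>i \<alpha>\<^sup>i p\<^sub>i / q\<close>, and \<open>inverse_rel\<close>
  is the expansion of the inverse of \<open>u\<close> at the generic element, with denominators
  cleared.\<close>

locale hypercircle_data = primitive_extension +
  fixes a b c d :: 'a and p :: "nat \<Rightarrow> 'a poly" and q :: "'a poly" and r :: "nat \<Rightarrow> 'a mpoly" and s :: "'a mpoly"
  assumes coeffs_L: "a \<in> L" "b \<in> L" "c \<in> L" "d \<in> L" and det_nz: "a * d - b * c \<noteq> 0"
    and q_over: "q \<in> poly_over K" and q_nz: "q \<noteq> 0" and p_over: "i < n \<Longrightarrow> p i \<in> poly_over K"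
    and bezout: "\<exists>e f. e * q + (\<Sum>i<n. f i * p i) = 1"
    and param: "[:b, a:] * q = (\<Sum>i<n. [:\<alpha> ^ i:] * p i) * [:d, c:]"
    and r_over: "i < n \<Longrightarrow> r i \<in> mpoly_over K {..<n}"
    and s_over: "s \<in> mpoly_over K {..<n}" and s_nz: "s \<noteq> 0"
    and inverse_rel: "linear_form n a c \<alpha> * (\<Sum>i<n. mconst (\<alpha> ^ i) * r i) =
      s * (mconst d * generic_elt n \<alpha> - mconst b)"
begin

text \<open>Not restricted to indices below \<open>n\<close>, unlike the points of
  \<open>param_image\<close>; polynomials in \<open>X_0, ..., X_{n-1}\<close> do not see the
  difference.\<close>

definition point :: "'a \<Rightarrow> nat \<Rightarrow> 'a" where
  "point t i = poly (p i) t / poly q t"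

lemma meval_generic_elt: "meval x (generic_elt n \<beta>) = (\<Sum>i<n. \<beta> ^ i * x i)"
  by (simp add: generic_elt_def meval_sum)

lemma clear_denom_point:
  assumes P: "P \<in> mpoly_over UNIV {..<n}" and k: "\<And>m. m \<in> Poly_Mapping.keys P \<Longrightarrow> tdeg m \<le> k"
    and t: "poly q t \<noteq> 0"
  shows "poly (clear_denom (\<lambda>c. [:c:]) k p q P) t = poly q t ^ k * meval (point t) P"
proof -
  have "poly (clear_denom (\<lambda>c. [:c:]) k p q P) t
      = clear_denom ((\<lambda>p. poly p t) \<circ> (\<lambda>c. [:c:])) k ((\<lambda>p. poly p t) \<circ> p) (poly q t) P"
    by (rule clear_denom_hom[OF poly_eval_hom])
  also have "(\<lambda>p. poly p t) \<circ> (\<lambda>c. [:c:]) = id" by auto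
  also have "clear_denom id k ((\<lambda>p. poly p t) \<circ> p) (poly q t) P = poly q t ^ k * gev id (point t) P"
    using t by (intro clear_denom_eq[OF k P]) (auto simp: point_def)
  finally show ?thesis by (simp add: meval_eq_gev)
qed

lemma clear_denom_over:
  assumes "P \<in> mpoly_over K {..<n}"
  shows "clear_denom (\<lambda>c. [:c:]) k p q P \<in> poly_over K"
  unfolding clear_denom_def monom_val_def using assms
  by (intro poly_over_sum poly_over_mult poly_over_const poly_over_power poly_over_prod sring_K q_over p_over)
     (auto simp: mpoly_over_def)

text \<open>This is \<open>u(t) = X\<close> with all elements of \<open>L\<close> conjugated:
  \<open>param\<close>, written as a polynomial identity in \<alpha> over \<open>K[t]\<close>,
  carries over to \<beta>.\<close>

lemma conjugate_point:
  assumes P: "A \<in> poly_over K" "B \<in> poly_over K" "C \<in> poly_over K" "D \<in> poly_over K"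
    and ABCD: "poly A \<alpha> = a" "poly B \<alpha> = b" "poly C \<alpha> = c" "poly D \<alpha> = d"
    and \<beta>: "\<beta> \<in> conjugates" and t: "poly q t \<noteq> 0"
  shows "poly A \<beta> * t + poly B \<beta> = meval (point t) (generic_elt n \<beta>) * (poly C \<beta> * t + poly D \<beta>)"
proof -
  \<comment> \<open>The variable \<open>mvar 0\<close> plays the role of \<open>t\<close>, and is
    given its value only after the transfer to \<beta>.\<close>
  let ?T = "mvar 0 :: 'a mpoly" and ?m = "map_poly mconst :: 'a poly \<Rightarrow> 'a mpoly poly"
  interpret up: comm_ring_hom "upoly ?T" by (rule upoly_hom)
  define H where "H = (?m A * [:?T:] + ?m B) * [:upoly ?T q:]
      - (\<Sum>i<n. Polynomial.monom (upoly ?T (p i)) i) * (?m C * [:?T:] + ?m D)"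
  have ev: "poly H (mconst x) = (mconst (poly A x) * ?T + mconst (poly B x)) * upoly ?T q
      - (\<Sum>i<n. mconst (x ^ i) * upoly ?T (p i)) * (mconst (poly C x) * ?T + mconst (poly D x))" for x
    by (simp add: H_def poly_map_poly_mconst poly_sum poly_monom mconst_power mult.commute[of "upoly _ _"] mult.commute[of "mvar 0"])
  have T: "?T \<in> mpoly_over K UNIV" by (intro mpoly_over_mvar sring_K) simp
  have "H \<in> poly_over (mpoly_over K UNIV)"
    unfolding H_def
    by (intro poly_over_diff poly_over_mult poly_over_add poly_over_sum poly_over_const poly_over_monom
        sring_mpoly_over map_poly_mconst_over sring_K P T upoly_over q_over p_over) auto
  moreover have "poly H (mconst \<alpha>) = 0"
    using arg_cong[OF param, of "upoly ?T"]
    by (simp add: ev ABCD up.hom_mult up.hom_sum algebra_simps del: mult_pCons_left mult_pCons_right)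
  ultimately have "poly H (mconst \<beta>) = 0" using \<beta> by (rule conjugate_transfer)
  from arg_cong[OF this, of "meval (\<lambda>_. t)"]
  have "(poly A \<beta> * t + poly B \<beta>) * poly q t = (\<Sum>i<n. \<beta> ^ i * poly (p i) t) * (poly C \<beta> * t + poly D \<beta>)"
    by (simp add: ev meval_sum meval_upoly)
  moreover have "meval (point t) (generic_elt n \<beta>) * poly q t = (\<Sum>i<n. \<beta> ^ i * poly (p i) t)"
    unfolding meval_generic_elt sum_distrib_right using t by (intro sum.cong) (auto simp: point_def)
  ultimately have "(poly A \<beta> * t + poly B \<beta>) * poly q t
      = (meval (point t) (generic_elt n \<beta>) * (poly C \<beta> * t + poly D \<beta>)) * poly q t"
    by (simp add: mult_ac)
  then show ?thesis using t by simp
qed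

lemma coefficient_polys:
  obtains A B C D where "A \<in> poly_over K" "B \<in> poly_over K" "C \<in> poly_over K" "D \<in> poly_over K"
    "poly A \<alpha> = a" "poly B \<alpha> = b" "poly C \<alpha> = c" "poly D \<alpha> = d"
  using coeffs_L by (metis L_imp_poly)

text \<open>If \<open>A = C y\<close> at \<beta>, the conjugated relation gives
  \<open>C (A t + B) = A (C t + D)\<close>, so \<open>A D - B C\<close> vanishes at \<beta>; but
  this is a conjugate of the nonzero determinant.\<close>

lemma linear_form_point:
  assumes P: "A \<in> poly_over K" "B \<in> poly_over K" "C \<in> poly_over K" "D \<in> poly_over K"
    and ABCD: "poly A \<alpha> = a" "poly B \<alpha> = b" "poly C \<alpha> = c" "poly D \<alpha> = d"
    and \<beta>: "\<beta> \<in> conjugates" and t: "poly q t \<noteq> 0"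
  shows "meval (point t) (linear_form n (poly A \<beta>) (poly C \<beta>) \<beta>) \<noteq> 0"
proof
  let ?y = "meval (point t) (generic_elt n \<beta>)"
  assume "meval (point t) (linear_form n (poly A \<beta>) (poly C \<beta>) \<beta>) = 0"
  then have ya: "poly A \<beta> = poly C \<beta> * ?y" by (simp add: linear_form_def)
  have "poly C \<beta> * (poly A \<beta> * t + poly B \<beta>) = (poly C \<beta> * ?y) * (poly C \<beta> * t + poly D \<beta>)"
    unfolding conjugate_point[OF P ABCD \<beta> t] by simp
  also have "\<dots> = poly A \<beta> * (poly C \<beta> * t + poly D \<beta>)" by (simp add: ya)
  finally have "poly (A * D - B * C) \<beta> = 0" by (simp add: algebra_simps)
  moreover have "poly (A * D - B * C) \<beta> \<noteq> 0"
    by (rule conjugate_nonzero[OF _ _ \<beta>])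
       (use P ABCD det_nz in \<open>auto intro!: poly_over_diff poly_over_mult sring_K\<close>)
  ultimately show False by simp
qed

lemma alpha_conjugate: "\<alpha> \<in> conjugates"
  by (simp add: conjugates_def)

text \<open>At the point, \<open>d X - b = (a - c X) t\<close> because \<open>X = u(t)\<close>; the
  nonzero factor \<open>a - c X\<close> cancels from the expansion of the inverse.\<close>

lemma meval_r_sum:
  assumes t: "poly q t \<noteq> 0"
  shows "(\<Sum>i<n. \<alpha> ^ i * meval (point t) (r i)) = t * meval (point t) s"
proof -
  obtain A B C D where P: "A \<in> poly_over K" "B \<in> poly_over K" "C \<in> poly_over K" "D \<in> poly_over K"
    "poly A \<alpha> = a" "poly B \<alpha> = b" "poly C \<alpha> = c" "poly D \<alpha> = d" by (rule coefficient_polys)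
  let ?y = "meval (point t) (generic_elt n \<alpha>)"
  have y: "a * t + b = ?y * (c * t + d)"
    using conjugate_point[OF P alpha_conjugate t] P by simp
  have nz: "a - c * ?y \<noteq> 0"
    using linear_form_point[OF P alpha_conjugate t] P by (simp add: linear_form_def)
  have "(a - c * ?y) * (\<Sum>i<n. \<alpha> ^ i * meval (point t) (r i)) = meval (point t) s * (d * ?y - b)"
    using arg_cong[OF inverse_rel, of "meval (point t)"] by (simp add: linear_form_def meval_sum)
  also have "d * ?y - b = (a - c * ?y) * t" using y by (simp add: algebra_simps)
  finally show ?thesis using nz by (simp add: mult_ac)
qed

text \<open>For a single \<open>t\<close> the values need not lie in \<open>K\<close>, so powers of
  \<alpha> cannot be compared pointwise. After clearing denominators the relation is an identity in
  \<open>t\<close>, whose coefficients can be compared over \<open>K\<close>.\<close>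

lemma meval_r_eq_0:
  assumes i: "0 < i" "i < n" and t: "poly q t \<noteq> 0"
  shows "meval (point t) (r i) = 0"
proof -
  \<comment> \<open>A common bound for \<open>s\<close> and all \<open>r j\<close> makes the same
    power of \<open>q\<close> appear in every term.\<close>
  obtain k where k: "\<And>P m. P \<in> insert s (r ` {..<n}) \<Longrightarrow> m \<in> Poly_Mapping.keys P \<Longrightarrow> tdeg m \<le> k"
    using finite_tdeg_bound[of "insert s (r ` {..<n})"] by auto
  define H where "H = clear_denom (\<lambda>c. [:c:]) k p q"
  have over: "r j \<in> mpoly_over UNIV {..<n}" if "j < n" for j
    using mpoly_over_mono[OF _ _ r_over[OF that]] by blast
  have s': "s \<in> mpoly_over UNIV {..<n}" using mpoly_over_mono[OF _ _ s_over] by blast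
  have ev: "poly (H (r j)) t = poly q t ^ k * meval (point t) (r j)" if "j < n" "poly q t \<noteq> 0" for j t
    unfolding H_def using k that by (intro clear_denom_point over) auto
  have ev_s: "poly (H s) t = poly q t ^ k * meval (point t) s" if "poly q t \<noteq> 0" for t
    unfolding H_def using k that by (intro clear_denom_point s') auto
  have "(\<Sum>j<n. [:\<alpha> ^ j:] * H (r j)) - [:0, 1:] * H s = 0"
  proof (rule poly_eq_0_off_roots[OF q_nz])
    fix t assume t: "poly q t \<noteq> 0"
    have "poly (\<Sum>j<n. [:\<alpha> ^ j:] * H (r j)) t = (\<Sum>j<n. \<alpha> ^ j * poly (H (r j)) t)"
      by (simp add: poly_sum)
    also have "\<dots> = poly q t ^ k * (\<Sum>j<n. \<alpha> ^ j * meval (point t) (r j))"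
      unfolding sum_distrib_left using ev[OF _ t] by (intro sum.cong) auto
    also have "\<dots> = poly ([:0, 1:] * H s) t"
      unfolding meval_r_sum[OF t] using ev_s[OF t] by simp
    finally show "poly ((\<Sum>j<n. [:\<alpha> ^ j:] * H (r j)) - [:0, 1:] * H s) t = 0" by simp
  qed
  then have eq: "(\<Sum>j<n. [:\<alpha> ^ j:] * H (r j)) = [:0, 1:] * H s" by simp
  have "H (r i) = 0"
  proof (rule poly_eqI)
    fix l
    \<comment> \<open>The right-hand side \<open>t s\<close> has its coefficients in
      \<open>K\<close>, so it belongs to the power \<alpha>^0 and affects only the index
      \<open>0\<close>.\<close>
    let ?k = "\<lambda>j. poly.coeff (H (r j)) l - (if j = 0 then poly.coeff ([:0, 1:] * H s) l else 0)"
    have 0: "(\<Sum>j<n. ?k j * \<alpha> ^ j) = 0"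
    proof -
      have "(\<Sum>j<n. ?k j * \<alpha> ^ j) = (\<Sum>j<n. \<alpha> ^ j * poly.coeff (H (r j)) l)
          - (\<Sum>j<n. if j = 0 then poly.coeff ([:0, 1:] * H s) l else 0)"
        unfolding sum_subtractf[symmetric] by (intro sum.cong) (auto simp: algebra_simps)
      also have "(\<Sum>j<n. if j = 0 then poly.coeff ([:0, 1:] * H s) l else 0) = poly.coeff ([:0, 1:] * H s) l"
        using n_pos by simp
      also have "(\<Sum>j<n. \<alpha> ^ j * poly.coeff (H (r j)) l) = poly.coeff (\<Sum>j<n. [:\<alpha> ^ j:] * H (r j)) l"
        by (simp add: coeff_sum)
      finally show ?thesis unfolding eq by simp
    qed
    have "H P \<in> poly_over K" if "P \<in> mpoly_over K {..<n}" for P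
      unfolding H_def by (rule clear_denom_over[OF that])
    then have "?k j \<in> K" if "j < n" for j
      using r_over[OF that] s_over
      by (auto simp: poly_over_def coeff_pCons intro!: sringD[OF sring_K] split: nat.split)
    from indep[OF this 0 i(2)] show "poly.coeff (H (r i)) l = poly.coeff 0 l" using i by simp
  qed
  then show ?thesis using ev[OF i(2) t] t by simp
qed

text \<open>Irreducibility of the curve in the form needed here: after clearing denominators,
  \<open>s\<close> and \<open>P\<close> become elements of the domain \<open>F[t]\<close> with
  product zero, the first of them nonzero.\<close>

lemma vanishing_product:
  assumes P: "P \<in> mpoly_over UNIV {..<n}" and s: "\<exists>t. poly q t \<noteq> 0 \<and> meval (point t) s \<noteq> 0"
    and van: "\<And>t. poly q t \<noteq> 0 \<Longrightarrow> meval (point t) s \<noteq> 0 \<Longrightarrow> meval (point t) P = 0"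
    and t: "poly q t \<noteq> 0"
  shows "meval (point t) P = 0"
proof -
  obtain k where k: "\<And>Q m. Q \<in> {s, P} \<Longrightarrow> m \<in> Poly_Mapping.keys Q \<Longrightarrow> tdeg m \<le> k"
    using finite_tdeg_bound[of "{s, P}"] by auto
  define H where "H = clear_denom (\<lambda>c. [:c:]) k p q"
  have s': "s \<in> mpoly_over UNIV {..<n}" using mpoly_over_mono[OF _ _ s_over] by blast
  have ev: "poly (H Q) t = poly q t ^ k * meval (point t) Q" if "Q \<in> {s, P}" "poly q t \<noteq> 0" for Q t
    unfolding H_def using k[OF that(1)] that P s' by (intro clear_denom_point) auto
  have "H s * H P = 0"
  proof (rule poly_eq_0_off_roots[OF q_nz])
    fix t assume "poly q t \<noteq> 0"
    then show "poly (H s * H P) t = 0" using van[of t] ev[of s t] ev[of P t] by auto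
  qed
  moreover have "H s \<noteq> 0" using s ev[of s] by fastforce
  ultimately have "H P = 0" by simp
  then show ?thesis using ev[of P t] t by simp
qed

text \<open>\<open>s\<close> is a product of conjugate forms, which vanish at no parametrized point,
  times a common factor \<open>h\<close> of \<open>s\<close> and all \<open>r i\<close>, to which
  the hypothesis on common factors applies.\<close>

lemma s_not_vanishing:
  assumes U: "vanishing_ideal n U = {P \<in> mpoly_over UNIV {..<n}. \<forall>t. poly q t \<noteq> 0 \<longrightarrow> meval (point t) P = 0}"
    and red: "no_common_factor_vanishing_on K n U r s"
  shows "\<exists>t. poly q t \<noteq> 0 \<and> meval (point t) s \<noteq> 0"
proof -
  obtain A B C D where P: "A \<in> poly_over K" "B \<in> poly_over K" "C \<in> poly_over K" "D \<in> poly_over K"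
    "poly A \<alpha> = a" "poly B \<alpha> = b" "poly C \<alpha> = c" "poly D \<alpha> = d" by (rule coefficient_polys)
  obtain h S where h: "h \<in> mpoly_over K {..<n}" "h dvd s" "\<And>i. i < n \<Longrightarrow> h dvd r i"
    "S \<subseteq> conjugates" "finite S" "s = (\<Prod>\<beta>\<in>S. linear_form n (poly A \<beta>) (poly C \<beta>) \<beta>) * h"
    by (rule common_divisor[OF P(1-4), of r s]) (use P det_nz r_over s_over s_nz inverse_rel in auto)
  from red h obtain x where x: "x \<in> U" "meval x h \<noteq> 0"
    unfolding no_common_factor_vanishing_on_def by blast
  \<comment> \<open>The point \<open>x\<close> of \<open>U\<close> may lie outside the parametrized
    part; the description of the vanishing ideal replaces it by a parametrized point.\<close>
  then have "h \<notin> vanishing_ideal n U" unfolding vanishing_ideal_def by auto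
  moreover have "h \<in> mpoly_over UNIV {..<n}" using mpoly_over_mono[OF _ _ h(1)] by blast
  ultimately obtain t where t: "poly q t \<noteq> 0" "meval (point t) h \<noteq> 0" unfolding U by blast
  then have "meval (point t) s \<noteq> 0"
    unfolding h(6) using linear_form_point[OF P _ t(1)] h(4,5) by (auto simp: meval_prod)
  with t show ?thesis by blast
qed

section \<open>The elimination ideal vanishes on the curve\<close>

lemma generators_over: "r ` {1..<n} \<union> {s * mvar n - 1} \<subseteq> mpoly_over K {..n}"
proof -
  have "s * mvar n - 1 \<in> mpoly_over K {..n}"
    by (intro mpoly_over_closed sring_K mpoly_over_mono[OF order.refl _ s_over]) auto
  moreover have "r i \<in> mpoly_over K {..n}" if "i < n" for i
    by (rule mpoly_over_mono[OF order.refl _ r_over[OF that]]) auto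
  ultimately show ?thesis by auto
qed

lemma ideal_imp_vanishing:
  assumes P: "P \<in> genideal (mpoly_ring TYPE('a) {..n}) (r ` {1..<n} \<union> {s * mvar n - 1})"
    and P': "P \<in> mpoly_over UNIV {..<n}"
    and s: "\<exists>t. poly q t \<noteq> 0 \<and> meval (point t) s \<noteq> 0" and t: "poly q t \<noteq> 0"
  shows "meval (point t) P = 0"
proof -
  \<comment> \<open>The coordinate \<open>n\<close> is \<open>Z\<close>; with the value
    \<open>1 / s\<close> there, all generators vanish wherever \<open>s\<close> is nonzero. The
    other parameters are reached through \<open>vanishing_product\<close>.\<close>
  define x where "x t = (point t)(n := inverse (meval (point t) s))" for t
  define I where "I = {P \<in> mpoly_over UNIV {..n}. \<forall>t. poly q t \<noteq> 0 \<longrightarrow> meval (point t) s \<noteq> 0 \<longrightarrow> meval (x t) P = 0}"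
  have x_eq: "meval (x t) Q = meval (point t) Q" if "Q \<in> mpoly_over K' {..<n}" for Q K' t
    by (rule meval_cong[OF that]) (simp add: x_def)
  have "genideal (mpoly_ring TYPE('a) {..n}) (r ` {1..<n} \<union> {s * mvar n - 1}) \<subseteq> I"
  proof (rule genideal_subset)
    show "ideal_over (mpoly_over UNIV {..n}) I"
      unfolding ideal_over_def I_def by (auto intro!: mpoly_over_add mpoly_over_mult sring_UNIV)
    show "I \<subseteq> mpoly_over UNIV {..n}" by (auto simp: I_def)
    show "r ` {1..<n} \<union> {s * mvar n - 1} \<subseteq> I"
    proof
      fix g assume g: "g \<in> r ` {1..<n} \<union> {s * mvar n - 1}"
      have "meval (x t) g = 0" if "poly q t \<noteq> 0" "meval (point t) s \<noteq> 0" for t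
        using g that x_eq[OF s_over, of t] x_eq[OF r_over, of _ t] meval_r_eq_0[of _ t]
        by (auto simp: x_def)
      moreover have "g \<in> mpoly_over UNIV {..n}"
        using generators_over g mpoly_over_mono[of K UNIV "{..n}" "{..n}"] by blast
      ultimately show "g \<in> I" unfolding I_def by simp
    qed
  qed
  then have "P \<in> I" using P by blast
  then show ?thesis
    using vanishing_product[OF P' s _ t] x_eq[OF P'] unfolding I_def by auto
qed

section \<open>The ideal over \<open>K\<close> and its extension to \<open>L\<close>\<close>

definition ideal_K :: "'a mpoly set" where
  "ideal_K = {(\<Sum>i\<in>{1..<n}. A i * r i) + B * (s * mvar n - 1) | A B.
     (\<forall>i. A i \<in> mpoly_over K {..n}) \<and> B \<in> mpoly_over K {..n}}"

lemma ideal_over_ideal_K: "ideal_over (mpoly_over K {..n}) ideal_K"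
  unfolding ideal_over_def
proof (intro conjI ballI)
  show "0 \<in> ideal_K"
    unfolding ideal_K_def by (intro CollectI exI[of _ "\<lambda>_. 0"] exI[of _ 0]) simp
next
  fix x y assume "x \<in> ideal_K" "y \<in> ideal_K"
  then obtain A B A' B' where *: "x = (\<Sum>i\<in>{1..<n}. A i * r i) + B * (s * mvar n - 1)"
    "\<forall>i. A i \<in> mpoly_over K {..n}" "B \<in> mpoly_over K {..n}"
    "y = (\<Sum>i\<in>{1..<n}. A' i * r i) + B' * (s * mvar n - 1)"
    "\<forall>i. A' i \<in> mpoly_over K {..n}" "B' \<in> mpoly_over K {..n}"
    unfolding ideal_K_def by auto
  show "x + y \<in> ideal_K"
    unfolding ideal_K_def
  proof (intro CollectI exI conjI)
    show "x + y = (\<Sum>i\<in>{1..<n}. (A i + A' i) * r i) + (B + B') * (s * mvar n - 1)"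
      unfolding *(1,4) by (simp add: distrib_right sum.distrib)
  qed (use * in \<open>auto intro: mpoly_over_add sring_K\<close>)
next
  fix w x assume w: "w \<in> mpoly_over K {..n}" and "x \<in> ideal_K"
  then obtain A B where *: "x = (\<Sum>i\<in>{1..<n}. A i * r i) + B * (s * mvar n - 1)"
    "\<forall>i. A i \<in> mpoly_over K {..n}" "B \<in> mpoly_over K {..n}"
    unfolding ideal_K_def by auto
  show "w * x \<in> ideal_K"
    unfolding ideal_K_def
  proof (intro CollectI exI conjI)
    show "w * x = (\<Sum>i\<in>{1..<n}. (w * A i) * r i) + (w * B) * (s * mvar n - 1)"
      unfolding *(1) by (simp add: distrib_left sum_distrib_left mult.assoc)
  qed (use * w in \<open>auto intro: mpoly_over_mult sring_K\<close>)
qed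

lemma generators_ideal_K: "0 < i \<Longrightarrow> i < n \<Longrightarrow> r i \<in> ideal_K" "s * mvar n - 1 \<in> ideal_K"
proof -
  show "r i \<in> ideal_K" if "0 < i" "i < n"
    unfolding ideal_K_def using that
    by (intro CollectI exI[of _ "\<lambda>j. if j = i then 1 else 0"] exI[of _ 0])
       (auto intro: mpoly_over_1 sring_K simp: if_distrib[of "\<lambda>z. z * _"] cong: if_cong)
  show "s * mvar n - 1 \<in> ideal_K"
    unfolding ideal_K_def
    by (intro CollectI exI[of _ "\<lambda>_. 0"] exI[of _ 1]) (auto intro: mpoly_over_1 sring_K)
qed

lemma ideal_K_over: "x \<in> ideal_K \<Longrightarrow> x \<in> mpoly_over K {..n}"
proof -
  assume "x \<in> ideal_K"
  then obtain A B where *: "x = (\<Sum>i\<in>{1..<n}. A i * r i) + B * (s * mvar n - 1)"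
    "\<forall>i. A i \<in> mpoly_over K {..n}" "B \<in> mpoly_over K {..n}"
    unfolding ideal_K_def by auto
  have "(\<Sum>i\<in>{1..<n}. A i * r i) \<in> mpoly_over K {..n}"
    using *(2) generators_over by (intro mpoly_over_sum mpoly_over_mult sring_K) auto
  moreover have "B * (s * mvar n - 1) \<in> mpoly_over K {..n}"
    by (intro mpoly_over_mult sring_K *(3) subsetD[OF generators_over]) auto
  ultimately show ?thesis unfolding *(1) by (rule mpoly_over_add[OF sring_K])
qed

text \<open>The extension of \<open>ideal_K\<close> to coefficients in \<open>L\<close>, given by
  expansions in powers of \<alpha>. By uniqueness of expansions, membership can be tested
  coefficient by coefficient.\<close>

definition ideal_L :: "'a mpoly set" where
  "ideal_L = {\<Sum>i<n. mconst (\<alpha> ^ i) * h i | h. \<forall>i<n. h i \<in> ideal_K}"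

lemma ideal_over_ideal_L: "ideal_over (mpoly_over L {..n}) ideal_L"
proof -
  note I = ideal_over_ideal_K
  have add: "x + y \<in> ideal_L" if xy: "x \<in> ideal_L" "y \<in> ideal_L" for x y
  proof -
    from xy obtain h h' where *: "x = (\<Sum>i<n. mconst (\<alpha> ^ i) * h i)" "\<forall>i<n. h i \<in> ideal_K"
      "y = (\<Sum>i<n. mconst (\<alpha> ^ i) * h' i)" "\<forall>i<n. h' i \<in> ideal_K"
      unfolding ideal_L_def by blast
    show ?thesis
      unfolding ideal_L_def
    proof (intro CollectI exI conjI)
      show "x + y = (\<Sum>i<n. mconst (\<alpha> ^ i) * (h i + h' i))"
        unfolding * by (simp add: distrib_left sum.distrib)
    qed (use * in \<open>auto intro: ideal_overD[OF I]\<close>)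
  qed
  have zero: "0 \<in> ideal_L"
    unfolding ideal_L_def by (intro CollectI exI[of _ "\<lambda>_. 0"]) (auto intro: ideal_overD[OF I])
  \<comment> \<open>Products produce powers of \<alpha> beyond \<open>n - 1\<close>; they are
    rewritten in the basis.\<close>
  have basis: "mconst (\<alpha> ^ j) * h \<in> ideal_L" if h: "h \<in> ideal_K" for h j
  proof -
    have "\<alpha> ^ j \<in> L" by (intro sring_power sring_L alpha_L)
    then obtain k where k: "\<alpha> ^ j = (\<Sum>i<n. k i * \<alpha> ^ i)" "\<forall>i<n. k i \<in> K"
      unfolding L_eq by blast
    show ?thesis
      unfolding ideal_L_def
    proof (intro CollectI exI conjI)
      have "mconst (\<Sum>i<n. k i * \<alpha> ^ i) = (\<Sum>i<n. mconst (\<alpha> ^ i) * mconst (k i))"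
        by (induction n) (auto simp: mconst_add mconst_mult mult.commute)
      then show "mconst (\<alpha> ^ j) * h = (\<Sum>i<n. mconst (\<alpha> ^ i) * (mconst (k i) * h))"
        unfolding k(1) by (simp add: sum_distrib_right mult.assoc)
    qed (use k h in \<open>auto intro!: ideal_overD[OF I] mpoly_over_mconst sring_K\<close>)
  qed
  have sum: "sum f A \<in> ideal_L" if "\<And>i. i \<in> A \<Longrightarrow> f i \<in> ideal_L" for f :: "nat \<Rightarrow> 'a mpoly" and A
    using that by (induction A rule: infinite_finite_induct) (auto intro: add zero)
  have mult: "w * x \<in> ideal_L" if w: "w \<in> mpoly_over L {..n}" and x: "x \<in> ideal_L" for w x
  proof -
    obtain g where g: "\<And>i. i < n \<Longrightarrow> g i \<in> mpoly_over K {..n}" "w = (\<Sum>i<n. mconst (\<alpha> ^ i) * g i)"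
      using mpoly_expand[OF w] by blast
    obtain h where h: "x = (\<Sum>i<n. mconst (\<alpha> ^ i) * h i)" "\<forall>i<n. h i \<in> ideal_K"
      using x unfolding ideal_L_def by blast
    have "w * x = (\<Sum>i<n. \<Sum>j<n. mconst (\<alpha> ^ (i + j)) * (g i * h j))"
      unfolding g(2) h(1) sum_product by (simp add: power_add mconst_mult mult_ac)
    also have "\<dots> \<in> ideal_L"
      by (intro sum basis ideal_overD(3)[OF I] g(1)) (use h in auto)
    finally show ?thesis .
  qed
  show ?thesis unfolding ideal_over_def using add zero mult by blast
qed

lemma ideal_K_subset_L: "h \<in> ideal_K \<Longrightarrow> j < n \<Longrightarrow> mconst (\<alpha> ^ j) * h \<in> ideal_L"
  unfolding ideal_L_def
proof (intro CollectI exI conjI allI impI)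
  assume h: "h \<in> ideal_K" and j: "j < n"
  have "(\<Sum>i<n. mconst (\<alpha> ^ i) * (if i = j then h else 0)) = (\<Sum>i<n. if i = j then mconst (\<alpha> ^ j) * h else 0)"
    by (intro sum.cong) auto
  then show "mconst (\<alpha> ^ j) * h = (\<Sum>i<n. mconst (\<alpha> ^ i) * (if i = j then h else 0))"
    using j by simp
  show "(if i = j then h else 0) \<in> ideal_K" for i
    using h ideal_overD(1)[OF ideal_over_ideal_K] by simp
qed

lemma ideal_L_coefficients:
  assumes "(\<Sum>i<n. mconst (\<alpha> ^ i) * g i) \<in> ideal_L" and g: "\<And>i. i < n \<Longrightarrow> g i \<in> mpoly_over K {..n}" and "j < n"
  shows "g j \<in> ideal_K"
proof -
  obtain h where h: "(\<Sum>i<n. mconst (\<alpha> ^ i) * g i) = (\<Sum>i<n. mconst (\<alpha> ^ i) * h i)" "\<forall>i<n. h i \<in> ideal_K"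
    using assms(1) unfolding ideal_L_def by blast
  have "(\<Sum>i<n. mconst (\<alpha> ^ i) * (g i - h i)) = 0"
    using h(1) by (simp add: right_diff_distrib sum_subtractf)
  then have "g j - h j = 0"
    using h(2) by (intro mpoly_indep[where V = "{..n}" and g = "\<lambda>j. g j - h j"] mpoly_over_diff sring_K g ideal_K_over \<open>j < n\<close>) auto
  then show ?thesis using h(2) \<open>j < n\<close> by simp
qed

text \<open>Modulo the ideal, \<open>T = r\<^sub>0 Z\<close> is the parameter of the generic point: \<open>X\<^sub>i = \<phi>\<^sub>i(T)\<close>.\<close>

lemma coordinate_relation:
  assumes "i < n"
  shows "upoly (r 0 * mvar n) (p i) - mvar i * upoly (r 0 * mvar n) q \<in> ideal_K"
proof -
  let ?Z = "mvar n :: 'a mpoly" and ?c = "mconst :: 'a \<Rightarrow> 'a mpoly"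
  define T where "T = r 0 * ?Z"
  define \<xi> where "\<xi> = generic_elt n \<alpha>"
  \<comment> \<open>\<open>e1\<close> and \<open>e2\<close> lie in the extended ideal.
    \<open>e3\<close> is the error in \<open>a T + b = \<xi> (c T + d)\<close>, that is, in
    \<open>X = u(T)\<close>.\<close>
  define e1 where "e1 = (\<Sum>i\<in>{1..<n}. ?c (\<alpha> ^ i) * r i)"
  define e2 where "e2 = s * ?Z - 1"
  define e3 where "e3 = e2 * (?c d * \<xi> - ?c b) - (?c a - ?c c * \<xi>) * ?Z * e1"
  define Q where "Q = upoly T q"
  define Y where "Y = (\<Sum>i<n. ?c (\<alpha> ^ i) * upoly T (p i))"
  interpret up: comm_ring_hom "upoly T" by (rule upoly_hom)
  note I = ideal_over_ideal_L
  have r0: "r 0 \<in> mpoly_over K {..n}" by (rule mpoly_over_mono[OF order.refl _ r_over[OF n_pos]]) auto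
  have T_K: "T \<in> mpoly_over K {..n}"
    unfolding T_def by (intro mpoly_over_mult mpoly_over_mvar sring_K r0) auto
  have T_L: "T \<in> mpoly_over L {..n}" using mpoly_over_mono[OF K_subset_L order.refl T_K] .
  have \<xi>_L: "\<xi> \<in> mpoly_over L {..n}"
    unfolding \<xi>_def by (intro generic_elt_over sring_L alpha_L) auto
  have Z_L: "?Z \<in> mpoly_over L {..n}" by (intro mpoly_over_mvar sring_L) auto
  have K_L: "x \<in> mpoly_over L {..n}" if "x \<in> mpoly_over K {..n}" for x
    using mpoly_over_mono[OF K_subset_L order.refl that] .
  have Q_K: "Q \<in> mpoly_over K {..n}" unfolding Q_def by (intro upoly_over sring_K q_over T_K)
  have up_p: "upoly T (p i) \<in> mpoly_over K {..n}" if "i < n" for i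
    by (intro upoly_over sring_K p_over T_K that)
  have Y_L: "Y \<in> mpoly_over L {..n}"
    unfolding Y_def using up_p K_L
    by (intro mpoly_over_sum mpoly_over_mult mpoly_over_mconst sring_power sring_L alpha_L) auto
  have "e1 \<in> ideal_L"
    unfolding e1_def by (intro ideal_over_sum[OF I] ideal_K_subset_L generators_ideal_K) auto
  moreover have "e2 \<in> ideal_L"
    using ideal_K_subset_L[OF generators_ideal_K(2) n_pos] by (simp add: e2_def)
  ultimately have e3: "e3 \<in> ideal_L"
    unfolding e3_def mult.commute[of e2]
    by (intro ideal_over_diff[OF I sring_mpoly_over[OF sring_L]] ideal_overD(3)[OF I]
        mpoly_over_closed sring_L coeffs_L \<xi>_L Z_L)
  have R: "(\<Sum>i<n. ?c (\<alpha> ^ i) * r i) = r 0 + e1"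
    unfolding e1_def using n_pos by (simp add: lessThan_atLeast0 sum.atLeast_Suc_lessThan)
  have "(?c a - ?c c * \<xi>) * (r 0 + e1) = s * (?c d * \<xi> - ?c b)"
    using inverse_rel unfolding R linear_form_def \<xi>_def .
  then have "(?c a - ?c c * \<xi>) * (r 0 + e1) * ?Z = s * (?c d * \<xi> - ?c b) * ?Z" by simp
  then have rel: "?c a * T + ?c b = \<xi> * (?c c * T + ?c d) + e3"
    unfolding e3_def e2_def T_def by (simp add: algebra_simps)
  have par: "Q * (?c a * T + ?c b) = (?c c * T + ?c d) * Y"
    using arg_cong[OF param, of "upoly T"] unfolding Q_def Y_def
    by (simp add: up.hom_mult up.hom_sum mult_ac add_ac del: mult_pCons_left mult_pCons_right)
  \<comment> \<open>Dividing by \<open>c T + d\<close> is avoided: up to a multiple of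
    \<open>e3\<close>, its product with \<open>a - c \<xi>\<close> is the determinant, a nonzero
    constant.\<close>
  have "(?c a * ?c d - ?c b * ?c c) * (Y - \<xi> * Q) = (Q * ?c a - ?c c * Y) * e3"
  proof -
    have "(?c c * T + ?c d) * (Y - \<xi> * Q) = Q * e3"
      using par unfolding rel by (simp add: algebra_simps)
    then have "(?c a - ?c c * \<xi>) * ((?c c * T + ?c d) * (Y - \<xi> * Q)) = (?c a - ?c c * \<xi>) * (Q * e3)"
      by simp
    moreover have "(?c a - ?c c * \<xi>) * (?c c * T + ?c d) = ?c a * ?c d - ?c b * ?c c + ?c c * e3"
      using arg_cong[OF rel, of "\<lambda>z. ?c c * z"] by (simp add: algebra_simps)
    ultimately have "(?c a * ?c d - ?c b * ?c c + ?c c * e3) * (Y - \<xi> * Q) = (?c a - ?c c * \<xi>) * (Q * e3)"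
      by (simp add: mult.assoc[symmetric])
    then show ?thesis by (simp add: algebra_simps)
  qed
  then have "?c (a * d - b * c) * (Y - \<xi> * Q) = (Q * ?c a - ?c c * Y) * e3"
    by (simp add: mconst_diff mconst_mult)
  then have "?c (inverse (a * d - b * c)) * (?c (a * d - b * c) * (Y - \<xi> * Q))
      = (?c (inverse (a * d - b * c)) * (Q * ?c a - ?c c * Y)) * e3"
    by (simp add: mult.assoc)
  then have "Y - \<xi> * Q = (?c (inverse (a * d - b * c)) * (Q * ?c a - ?c c * Y)) * e3"
    using det_nz by (simp add: mult.assoc[symmetric] mconst_mult[symmetric])
  also have "\<dots> \<in> ideal_L"
    by (intro ideal_overD(3)[OF I] e3 mpoly_over_mult mpoly_over_diff mpoly_over_mconst sring_L
        inverse_L coeffs_L sringD(4,6)[OF sring_L] K_L[OF Q_K] Y_L)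
  also have "Y - \<xi> * Q = (\<Sum>i<n. ?c (\<alpha> ^ i) * (upoly T (p i) - mvar i * Q))"
    unfolding Y_def \<xi>_def generic_elt_def
    by (simp add: right_diff_distrib sum_subtractf sum_distrib_right mult.assoc)
  \<comment> \<open>The coefficients in this expansion are over \<open>K\<close>, so each of them
    lies in the ideal over \<open>K\<close>.\<close>
  finally have "upoly T (p i) - mvar i * Q \<in> ideal_K"
    by (rule ideal_L_coefficients[OF _ _ assms])
       (auto intro!: mpoly_over_diff mpoly_over_mult mpoly_over_mvar sring_K up_p Q_K)
  then show ?thesis unfolding Q_def T_def .
qed

text \<open>Modulo the ideal, \<open>Q\<^sup>k P\<close> equals \<open>P(p(T)/q(T))\<close> with
  denominators cleared, which is zero since it already vanishes as a polynomial in \<open>t\<close>.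
  The Bezout identity makes \<open>Q\<close> invertible modulo the ideal.\<close>

lemma vanishing_imp_ideal:
  assumes P: "P \<in> mpoly_over UNIV {..<n}" and van: "\<And>t. poly q t \<noteq> 0 \<Longrightarrow> meval (point t) P = 0"
  shows "P \<in> genideal (mpoly_ring TYPE('a) {..n}) (r ` {1..<n} \<union> {s * mvar n - 1})"
proof -
  define I where "I = genideal (mpoly_ring TYPE('a) {..n}) (r ` {1..<n} \<union> {s * mvar n - 1})"
  let ?W = "mpoly_over UNIV {..n} :: 'a mpoly set"
  have K_W: "x \<in> ?W" if "x \<in> mpoly_over K {..n}" for x
    using mpoly_over_mono[OF _ _ that] by blast
  have W: "sring ?W" by (intro sring_mpoly_over sring_UNIV)
  have gens: "r ` {1..<n} \<union> {s * mvar n - 1} \<subseteq> ?W" using generators_over K_W by blast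
  note I = ideal_over_genideal(1)[OF gens, folded I_def]
  have "ideal_K \<subseteq> I"
  proof
    fix x assume "x \<in> ideal_K"
    then obtain A B where x: "x = (\<Sum>i\<in>{1..<n}. A i * r i) + B * (s * mvar n - 1)"
      "\<forall>i. A i \<in> mpoly_over K {..n}" "B \<in> mpoly_over K {..n}"
      unfolding ideal_K_def by auto
    show "x \<in> I"
      unfolding x(1) using ideal_over_genideal(2)[OF gens] x(2,3) K_W
      by (intro ideal_overD[OF I] ideal_over_sum[OF I]) (auto simp: I_def)
  qed
  define T where "T = r 0 * mvar n"
  have T: "T \<in> ?W"
    unfolding T_def
    by (intro mpoly_over_mult mpoly_over_mvar sring_UNIV mpoly_over_mono[OF _ _ r_over[OF n_pos]]) auto
  have up_W: "upoly T x \<in> ?W" for x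
    by (intro upoly_over sring_UNIV T) (simp add: poly_over_def)
  interpret up: comm_ring_hom "upoly T" by (rule upoly_hom)
  define Q where "Q = upoly T q"
  have rel: "upoly T (p i) - mvar i * Q \<in> I" if "i < n" for i
    using coordinate_relation[OF that] \<open>ideal_K \<subseteq> I\<close> unfolding T_def Q_def by blast
  obtain k where k: "\<And>m. m \<in> Poly_Mapping.keys P \<Longrightarrow> tdeg m \<le> k"
    using finite_tdeg_bound[of "{P}"] by auto
  have "clear_denom (\<lambda>c. [:c:]) k p q P = 0"
    by (rule poly_eq_0_off_roots[OF q_nz]) (use clear_denom_point[OF P k] van in auto)
  then have "upoly T (clear_denom (\<lambda>c. [:c:]) k p q P) = 0" by simp
  moreover have "upoly T \<circ> (\<lambda>c. [:c:]) = mconst" by auto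
  ultimately have 0: "clear_denom mconst k (upoly T \<circ> p) Q P = 0"
    using clear_denom_hom[OF upoly_hom, of T "\<lambda>c. [:c:]" k p q P] by (simp add: Q_def)
  have "clear_denom mconst k (upoly T \<circ> p) Q P - clear_denom mconst k (\<lambda>i. mvar i * Q) Q P \<in> I"
    by (rule clear_denom_ideal[OF I W P])
       (use rel up_W in \<open>auto simp: Q_def intro!: mpoly_over_mult mpoly_over_mvar mpoly_over_mconst sring_UNIV\<close>)
  moreover have "clear_denom mconst k (\<lambda>i. mvar i * Q) Q P = Q ^ k * P"
    using clear_denom_eq[OF k P, of "\<lambda>i. mvar i * Q" mvar Q mconst] by (simp add: gev_mconst_mvar)
  ultimately have "0 - Q ^ k * P \<in> I" using 0 by simp
  then have QP: "Q ^ k * P \<in> I"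
    using ideal_over_diff[OF I W ideal_overD(1)[OF I], of "0 - Q ^ k * P"] by simp
  obtain e f where ef: "e * q + (\<Sum>i<n. f i * p i) = 1" using bezout by blast
  \<comment> \<open>The inverse of \<open>Q\<close> modulo the ideal: the Bezout identity at
    \<open>T\<close>, with \<open>p\<^sub>i(T)\<close> replaced by \<open>X\<^sub>i Q\<close> and
    \<open>Q\<close> taken out.\<close>
  define E where "E = upoly T e + (\<Sum>i<n. upoly T (f i) * mvar i)"
  have E: "E \<in> ?W"
    unfolding E_def by (intro mpoly_over_add mpoly_over_sum mpoly_over_mult mpoly_over_mvar up_W sring_UNIV) auto
  have PW: "P \<in> ?W" by (rule mpoly_over_mono[OF order.refl _ P]) auto
  have QW: "Q \<in> ?W" unfolding Q_def by (rule up_W)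
  have "1 = upoly T e * Q + (\<Sum>i<n. upoly T (f i) * upoly T (p i))"
    using arg_cong[OF ef, of "upoly T"] by (simp add: up.hom_add up.hom_mult up.hom_sum Q_def)
  then have "1 - E * Q = (\<Sum>i<n. upoly T (f i) * (upoly T (p i) - mvar i * Q))"
    unfolding E_def by (simp add: algebra_simps sum_subtractf sum_distrib_left)
  also have "\<dots> \<in> I" by (intro ideal_over_sum[OF I] ideal_overD(3)[OF I] up_W rel) auto
  finally have "1 ^ k - (E * Q) ^ k \<in> I"
    by (intro ideal_over_power_diff[OF I W] mpoly_over_mult mpoly_over_1 sring_UNIV E QW)
  then have "P * (1 ^ k - (E * Q) ^ k) + E ^ k * (Q ^ k * P) \<in> I"
    by (intro ideal_overD[OF I] PW QP mpoly_over_power E sring_UNIV)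
  then have "P \<in> I" by (simp add: algebra_simps power_mult_distrib)
  then show ?thesis unfolding I_def .
qed

end

theorem proposition5p2:
  fixes K L :: "'f::field_char_0 set" and \<alpha> :: 'f and n :: nat
    and u v :: "'f poly fract" and U :: "(nat \<Rightarrow> 'f) set"
    and r :: "nat \<Rightarrow> 'f mpoly" and s :: "'f mpoly"
  assumes F_closure: "algebraic_closure (field_of TYPE('f)) K"
    and L_def: "L = generate_field (field_of TYPE('f)) (insert \<alpha> K)"
    and degree_L: "ring.dimension (field_of TYPE('f)) n K L"
    and u_unit: "is_unit_in L u"
    and U_hypercircle: "is_hypercircle K \<alpha> n u U"
    and v_in: "v \<in> rat_over L"
    and v_inverse: "is_comp_inverse u v"
    and r_in: "\<forall>i<n. r i \<in> mpoly_over K {..<n}"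
    and s_in: "s \<in> mpoly_over K {..<n}" and s_nonzero: "s \<noteq> 0"
    and v_expansion:
      "rat_subst mrat_const v (\<Sum>i<n. mrat_const (\<alpha> ^ i) * Fract (mvar i) 1) =
         (\<Sum>i<n. Fract (r i) s * mrat_const (\<alpha> ^ i))"
    and r_s_reduced: "no_common_factor_vanishing_on K n U r s"
  shows "vanishing_ideal n U =
           genideal (mpoly_ring TYPE('f) {..n}) (r ` {1..<n} \<union> {s * mvar n - 1})
             \<inter> mpoly_over UNIV {..<n}"
proof -
  interpret primitive_extension K L \<alpha> n
    by (rule primitive_extension_if_algebraic_closure[OF F_closure L_def degree_L])
  obtain a b c d where abcd: "a \<in> L" "b \<in> L" "c \<in> L" "d \<in> L" "a * d - b * c \<noteq> 0"
    and u: "u = Fract [:b, a:] [:d, c:]"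
    using u_unit unfolding is_unit_in_def by blast
  have v: "v = Fract [:- b, d:] [:a, - c:]"
    by (rule comp_inverse_moebius[OF v_inverse u abcd(5)])
  obtain \<phi> where \<phi>: "\<And>i. i < n \<Longrightarrow> \<phi> i \<in> rat_over K" "u = (\<Sum>i<n. \<phi> i * rat_const (\<alpha> ^ i))"
    and U: "U = zariski_closure n (param_image n \<phi>)"
    using U_hypercircle unfolding is_hypercircle_def by blast
  \<comment> \<open>A common denominator in lowest terms, so that the parameters of the curve are
    exactly the \<open>t\<close> with \<open>q(t) \<noteq> 0\<close>.\<close>
  obtain p q where pq: "q \<in> poly_over K" "q \<noteq> 0" "\<And>i. i < n \<Longrightarrow> p i \<in> poly_over K"
    "\<And>i. i < n \<Longrightarrow> \<phi> i = Fract (p i) q" "\<exists>e f. e * q + (\<Sum>i<n. f i * p i) = 1"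
    by (rule common_denominator[OF sring_K inverse_K, of n \<phi>]) (use \<phi>(1) in blast)+
  have "u = (\<Sum>i<n. Fract ([:\<alpha> ^ i:] * p i) q)"
    unfolding \<phi>(2) using pq(4) by (intro sum.cong) (auto simp: rat_const_def mult.commute)
  also have "\<dots> = Fract (\<Sum>i<n. [:\<alpha> ^ i:] * p i) q" by (rule sum_Fract[OF pq(2)])
  finally have "Fract [:b, a:] [:d, c:] = Fract (\<Sum>i<n. [:\<alpha> ^ i:] * p i) q" unfolding u .
  moreover have "[:d, c:] \<noteq> 0" using abcd(5) by auto
  ultimately have param: "[:b, a:] * q = (\<Sum>i<n. [:\<alpha> ^ i:] * p i) * [:d, c:]"
    using pq(2) by (simp only: eq_fract simp_thms)
  interpret hypercircle_data K L \<alpha> n a b c d p q r s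
    by unfold_locales
      (use abcd pq param r_in s_in s_nonzero moebius_expansion[OF n_pos abcd(5) s_nonzero, of \<alpha> r] v_expansion v in auto)
  obtain e f where ef: "e * q + (\<Sum>i<n. f i * p i) = 1" using bezout by blast
  have image: "param_image n \<phi> = {restrict (point t) {..<n} | t. poly q t \<noteq> 0}"
    using param_image_common_denominator[OF pq(4,2) ef] by (simp add: point_def[abs_def])
  have "vanishing_ideal n U = vanishing_ideal n (param_image n \<phi>)"
    unfolding U by (rule vanishing_ideal_zariski_closure) (auto simp: image affine_space_def split: if_splits)
  also have "\<dots> = {P \<in> mpoly_over UNIV {..<n}. \<forall>t. poly q t \<noteq> 0 \<longrightarrow> meval (point t) P = 0}"
  proof -
    have "meval (restrict (point t) {..<n}) P = meval (point t) P" if "P \<in> mpoly_over UNIV {..<n}" for P t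
      by (rule meval_cong[OF that]) simp
    then show ?thesis unfolding vanishing_ideal_def image by auto
  qed
  finally have I_U: "vanishing_ideal n U
      = {P \<in> mpoly_over UNIV {..<n}. \<forall>t. poly q t \<noteq> 0 \<longrightarrow> meval (point t) P = 0}" .
  show ?thesis
  proof (intro equalityI subsetI IntI)
    fix P assume "P \<in> vanishing_ideal n U"
    then have P: "P \<in> mpoly_over UNIV {..<n}" "\<And>t. poly q t \<noteq> 0 \<Longrightarrow> meval (point t) P = 0"
      unfolding I_U by auto
    show "P \<in> mpoly_over UNIV {..<n}" by fact
    show "P \<in> genideal (mpoly_ring TYPE('f) {..n}) (r ` {1..<n} \<union> {s * mvar n - 1})"
      by (rule vanishing_imp_ideal[OF P])
  next
    fix P
    assume "P \<in> genideal (mpoly_ring TYPE('f) {..n}) (r ` {1..<n} \<union> {s * mvar n - 1}) \<inter> mpoly_over UNIV {..<n}"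
    then show "P \<in> vanishing_ideal n U"
      unfolding I_U using ideal_imp_vanishing s_not_vanishing[OF I_U r_s_reduced] by blast
  qed
qed

end
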